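(* Consider the Lur'e system and its Krasovskii regularization $\dot x\in F(x)$ as in the context, and suppose Assumptions 1 and 2 hold. Then the origin is globally asymptotically stable: every maximal solution of $\dot x\in F(x)$ is defined on $\mathbb{R}_{\ge0}$, and there exists $\beta\in\mathcal{KL}$ such that every solution $x$ satisfies $|x(t)|\le\beta(|x(0)|,t)$ for all $t\ge0$.
   Context: System: $\dot x=Ax+Bu$, $y=Cx$, $u=-\boldsymbol\psi(y)$, $x\in\mathbb{R}^n$, $u,y\in\mathbb{R}^p$, $\boldsymbol\psi(y)=(\psi_1(y_1),\dots,\psi_p(y_p))$. A function $\mathbb{R}\to\mathbb{R}$ is piecewise continuous if on every bounded interval it has finitely many discontinuity points, is continuous between them, and has finite one-sided limits there. Krasovskii regularization: $\boldsymbol\Psi_i(s):=\bigcap_{\delta>0}\overline{\mathrm{co}}\,\psi_i(s+\delta[-1,1])$, $\boldsymbol\Psi(y):=\boldsymbol\Psi_1(y_1)\times\dots\times\boldsymbol\Psi_p(y_p)$, $F(x):=\{Ax-Bw:w\in\boldsymbol\Psi(Cx)\}$. A solution of $\dot x\in F(x)$ is an absolutely continuous function on an interval containing $0$ satisfying $\dot x(t)\in F(x(t))$ for almost every $t$. Assumption 1: for each $i$, $\psi_i$ is piecewise continuous and there is $\zeta_i\in(0,+\infty]$ with $\psi_i(s)(\psi_i(s)-\zeta_is)\le0$ for all $s$ (for $\zeta_i=+\infty$: $\psi_i(s)s\ge0$ for all $s$). $Z:=\mathrm{diag}(\zeta_1^{-1},\dots,\zeta_p^{-1})$, $(+\infty)^{-1}:=0$.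 Assumption 2: there exist a diagonal $\Gamma>0$, a symmetric $P>0$ and $\eta>0$ such that $$\begin{bmatrix}PA+A^\top P+\eta I_n & PB-(C+\Gamma CA)^\top\\ B^\top P-(C+\Gamma CA) & -2Z-\Gamma CB-(\Gamma CB)^\top\end{bmatrix}\le0.$$ $\mathcal{KL}$: functions $\beta(r,t)$ that are class-$\mathcal{K}$ in $r$ for each $t$ and nonincreasing to $0$ in $t$ for each $r$. *)

theory Defs
  imports "HOL-Analysis.Analysis"
begin

definition piecewise_continuous :: "(real \<Rightarrow> real) \<Rightarrow> bool" where
  "piecewise_continuous f \<longleftrightarrow>
     (\<forall>a b. finite {s \<in> {a..b}. \<not> isCont f s}) \<and>
     (\<forall>s. \<exists>l. (f \<longlongrightarrow> l) (at_left s)) \<and>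
     (\<forall>s. \<exists>r. (f \<longlongrightarrow> r) (at_right s))"

definition kras :: "(real \<Rightarrow> real) \<Rightarrow> real \<Rightarrow> real set" where
  "kras f s = (\<Inter>\<delta>\<in>{0<..}. closure (convex hull (f ` {s - \<delta> .. s + \<delta>})))"

definition kras_vec :: "('p \<Rightarrow> real \<Rightarrow> real) \<Rightarrow> real^'p \<Rightarrow> (real^'p) set" where
  "kras_vec \<psi> y = {w. \<forall>i. w $ i \<in> kras (\<psi> i) (y $ i)}"

definition lure_F ::
  "real^'n^'n \<Rightarrow> real^'p^'n \<Rightarrow> real^'n^'p \<Rightarrow> ('p \<Rightarrow> real \<Rightarrow> real) \<Rightarrow> real^'n \<Rightarrow> (real^'n) set" where
  "lure_F A B C \<psi> x = {A *v x - B *v w | w. w \<in> kras_vec \<psi> (C *v x)}"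

definition abs_cont_on :: "real set \<Rightarrow> (real \<Rightarrow> 'a::real_normed_vector) \<Rightarrow> bool" where
  "abs_cont_on S f \<longleftrightarrow>
     (\<forall>\<epsilon>>0. \<exists>\<delta>>0. \<forall>D. finite D \<and> (\<forall>(u,v)\<in>D. u \<le> v \<and> {u..v} \<subseteq> S) \<and>
        pairwise (\<lambda>(u,v) (u',v'). {u<..<v} \<inter> {u'<..<v'} = {}) D \<and>
        (\<Sum>(u,v)\<in>D. v - u) < \<delta> \<longrightarrow> (\<Sum>(u,v)\<in>D. norm (f v - f u)) < \<epsilon>)"

definition di_solution :: "('a::euclidean_space \<Rightarrow> 'a set) \<Rightarrow> real set \<Rightarrow> (real \<Rightarrow> 'a) \<Rightarrow> bool" where
  "di_solution G I x \<longleftrightarrow>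
     is_interval I \<and> 0 \<in> I \<and>
     (\<forall>a b. {a..b} \<subseteq> I \<longrightarrow> abs_cont_on {a..b} x) \<and>
     (\<exists>N. N \<in> null_sets lebesgue \<and>
        (\<forall>t \<in> I - N. \<exists>v. (x has_vector_derivative v) (at t within I) \<and> v \<in> G (x t)))"

definition di_maximal_solution :: "('a::euclidean_space \<Rightarrow> 'a set) \<Rightarrow> real set \<Rightarrow> (real \<Rightarrow> 'a) \<Rightarrow> bool" where
  "di_maximal_solution G I x \<longleftrightarrow>
     di_solution G I x \<and>
     \<not> (\<exists>J y. di_solution G J y \<and> I \<subset> J \<and> (\<forall>t\<in>I. y t = x t))"

definition class_K :: "(real \<Rightarrow> real) \<Rightarrow> bool" where
  "class_K f \<longleftrightarrow> continuous_on {0..} f \<and> strict_mono_on {0..} f \<and> f 0 = 0"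

definition class_KL :: "(real \<Rightarrow> real \<Rightarrow> real) \<Rightarrow> bool" where
  "class_KL \<beta> \<longleftrightarrow>
     (\<forall>t\<ge>0. class_K (\<lambda>r. \<beta> r t)) \<and>
     (\<forall>r\<ge>0. antimono_on {0..} (\<lambda>t. \<beta> r t) \<and> ((\<lambda>t. \<beta> r t) \<longlongrightarrow> 0) at_top)"

definition inv_ereal0 :: "ereal \<Rightarrow> real" where
  "inv_ereal0 z = (if z = \<infinity> then 0 else 1 / real_of_ereal z)"

definition diag_mat :: "('p \<Rightarrow> real) \<Rightarrow> real^'p^'p" where
  "diag_mat d = (\<chi> i j. if i = j then d i else 0)"

end

(*
Lyapunov function V(x) = x'Px + 2 sum_i gamma_i (integral of psi_i from 0 to (Cx)_i). Along a
solution V o x is absolutely continuous. Where (Cx)_i crosses a jump of psi_i with nonzero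
speed the chain rule fails, but there are only countably many such times; where the speed is
zero, every w_i in the Krasovskii set gives the same derivative 0. Hence almost everywhere the
derivative of V is the quadratic expression in (x, w) of the matrix inequality taken at
omega = -w, and the sector condition leaves d/dt V <= -eta |x|^2.

With V <= alpha(|x|), alpha strictly increasing and continuous, and lam |x|^2 <= V, let
alpha(s) = V(x(t)). Then |x| >= s on [0,t], so eta t s^2 <= alpha(r) and s <= r with r = |x(0)|.
Adding the two, (1 + eta t) s^2 <= alpha(r) + r^2, which gives an explicit KL bound.

A bounded solution has bounded derivative, so it converges at the end of its interval; it
continues beyond an endpoint by Euler polygons. Their Lipschitz limit has a derivative almost
everywhere, and it lies in F because every half-space that contains F(x) and has a point v
outside F(x) strictly beyond it still contains nearby Euler velocities.
*)
theory Submission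
  imports Defs "HOL-Complex_Analysis.Great_Picard"
begin

section \<open>Absolutely continuous functions\<close>

text \<open>A solution comes with its own derivative off a null set, so for given solutions no
  differentiation theorem enters: a one-sided mean value inequality with a constant bound
  \<open>c\<close> carries the whole decay argument. A constant is enough because a lower bound on
  |x| over the time interval bounds the dissipation there, so |x|^2 is never integrated. Adding s^2
  <= r^2 serves small t: at t = 0 the decay estimate alone says nothing about s.

  Existence of the derivative has to be proved only for the curve built by Euler steps, and that
  curve is Lipschitz. The steps follow the original feedback, which may jump, so one cannot pass to
  the limit in the equation itself. Linear functionals help because a one-sided bound on a velocity
  component survives both the summation over steps and the limit.

  The KL estimate holds on whatever interval a solution lives on. It therefore precedes global
  existence and supplies the a priori bound for continuation.\<close>

lemma abs_cont_increment_le: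
  fixes f :: "real \<Rightarrow> real"
  assumes ab: "a \<le> b" and ac: "abs_cont_on {a..b} f" and N: "negligible N"
    and der: "\<And>t. t \<in> {a..b} - N \<Longrightarrow> \<exists>d\<le>c. (f has_real_derivative d) (at t within {a..b})"
  shows "f b - f a \<le> c * (b - a)"
proof -
  \<comment> \<open>Compare over a tagged division. Tags outside \<open>N\<close> use the derivative; the intervals tagged in
     \<open>N\<close> have small total length because the indicator of \<open>N\<close> has gauge integral 0.\<close>
  have main: "f b - f a \<le> (c + e) * (b - a) + 2 * e" if e: "e > 0" for e
  proof -
    obtain \<delta>0 where \<delta>0: "\<delta>0 > 0" and ac0: "\<And>D. finite D \<Longrightarrow> (\<forall>(u,v)\<in>D. u \<le> v \<and> {u..v} \<subseteq> {a..b}) \<Longrightarrow>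
        pairwise (\<lambda>(u,v) (u',v'). {u<..<v} \<inter> {u'<..<v'} = {}) D \<Longrightarrow>
        (\<Sum>(u,v)\<in>D. v - u) < \<delta>0 \<Longrightarrow> (\<Sum>(u,v)\<in>D. norm (f v - f u)) < e"
      using ac e unfolding abs_cont_on_def by meson
    \<comment> \<open>The derivative estimate omits the intervals tagged in \<open>N\<close>. For
      negative \<open>c\<close> this costs up to |c| times their total length, which the second
      entry keeps below \<open>e\<close>.\<close>
    define \<delta> where "\<delta> = min \<delta>0 (e / (\<bar>c\<bar> + 1))"
    have \<delta>: "\<delta> > 0" "\<delta> \<le> \<delta>0" using \<delta>0 e by (auto simp: \<delta>_def)
    have c\<delta>: "\<bar>c\<bar> * \<delta> \<le> e"
    proof -
      have "\<bar>c\<bar> * \<delta> \<le> \<bar>c\<bar> * (e / (\<bar>c\<bar> + 1))" by (intro mult_left_mono) (auto simp: \<delta>_def)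
      also have "\<dots> \<le> e" using e by (simp add: divide_simps algebra_simps)
      finally show ?thesis .
    qed
    have "(indicat_real N has_integral 0) (cbox a b)" using N by (simp add: negligible_def)
    then obtain \<gamma> where \<gamma>: "gauge \<gamma>" and \<gamma>2: "\<And>p. p tagged_division_of (cbox a b) \<Longrightarrow> \<gamma> fine p \<Longrightarrow>
          norm ((\<Sum>(x,k)\<in>p. measure lborel k *\<^sub>R indicat_real N x) - 0) < \<delta>"
      unfolding has_integral using \<delta>(1) by meson
    \<comment> \<open>Straddle form of the derivative: on an interval containing \<open>t\<close>,
      the errors to the left and right of \<open>t\<close> add up to at most \<open>e\<close> times
      its length.\<close>
    have "\<exists>d>0. \<forall>u v. u \<in> {a..b} \<and> v \<in> {a..b} \<and> u \<le> t \<and> t \<le> v \<and> \<bar>u - t\<bar> < d \<and> \<bar>v - t\<bar> < d \<longrightarrow> f v - f u \<le> (c + e) * (v - u)"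
      if t: "t \<in> {a..b} - N" for t
    proof -
      obtain D where D: "D \<le> c" "(f has_real_derivative D) (at t within {a..b})" using der[OF t] by blast
      obtain d where d: "d > 0" "\<And>y. y \<in> {a..b} \<Longrightarrow> \<bar>y - t\<bar> < d \<Longrightarrow> \<bar>f y - f t - D * (y - t)\<bar> \<le> e * \<bar>y - t\<bar>"
        using D(2) e unfolding has_field_derivative_def has_derivative_within_alt by force
      show ?thesis
      proof (intro exI[of _ d] conjI allI impI d(1), elim conjE)
        fix u v assume *: "u \<in> {a..b}" "v \<in> {a..b}" "u \<le> t" "t \<le> v" "\<bar>u - t\<bar> < d" "\<bar>v - t\<bar> < d"
        have "f v - f t - D * (v - t) \<le> e * (v - t)" using d(2)[of v] * by auto
        moreover have "f t - f u - D * (t - u) \<le> e * (t - u)" using d(2)[of u] * by (auto simp: algebra_simps abs_if split: if_splits)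
        ultimately have "f v - f u \<le> (D + e) * (v - u)" by (simp add: algebra_simps)
        also have "\<dots> \<le> (c + e) * (v - u)" using * D by (intro mult_right_mono) auto
        finally show "f v - f u \<le> (c + e) * (v - u)" .
      qed
    qed
    then obtain d where d: "\<And>t. t \<in> {a..b} - N \<Longrightarrow> d t > 0" "\<And>t u v. t \<in> {a..b} - N \<Longrightarrow> u \<in> {a..b} \<Longrightarrow> v \<in> {a..b} \<Longrightarrow> u \<le> t \<Longrightarrow> t \<le> v \<Longrightarrow> \<bar>u - t\<bar> < d t \<Longrightarrow> \<bar>v - t\<bar> < d t \<Longrightarrow> f v - f u \<le> (c + e) * (v - u)"
      by metis
    define \<gamma>' where "\<gamma>' t = (if t \<in> {a..b} - N then ball t (d t) else ball t 1)" for t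
    have "gauge \<gamma>'" unfolding gauge_def \<gamma>'_def using d(1) by auto
    then have "gauge (\<lambda>x. \<gamma> x \<inter> \<gamma>' x)" using \<gamma> by (intro gauge_Int)
    then obtain p where p: "p tagged_division_of {a..b}" and "(\<lambda>x. \<gamma> x \<inter> \<gamma>' x) fine p"
      using fine_division_exists_real by blast
    then have fine: "\<gamma> fine p" "\<gamma>' fine p" by (auto simp: fine_Int)
    have fin: "finite p" using p by blast
    have K: "Inf K \<le> Sup K \<and> K = {Inf K..Sup K} \<and> x \<in> K \<and> K \<subseteq> {a..b} \<and> measure lborel K = Sup K - Inf K" if xK: "(x,K) \<in> p" for x K
    proof -
      obtain u v where Kuv: "K = {u..v}" using tagged_division_ofD(4)[OF p xK] by (metis box_real(2))
      have "x \<in> K" "K \<subseteq> {a..b}" using tagged_division_ofD(2,3)[OF p xK] by auto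
      moreover have "u \<le> v" using \<open>x \<in> K\<close> Kuv by auto
      ultimately show ?thesis unfolding Kuv by simp
    qed
    define pN where "pN = {(x,K)\<in>p. x \<in> N}"
    \<comment> \<open>Without degenerate intervals, disjointness of interiors alone shows that the
      endpoints determine the member of the division; the dropped terms are zero.\<close>
    define pN' where "pN' = {(x,K)\<in>p. x \<in> N \<and> Inf K < Sup K}"
    define h where "h = (\<lambda>(x::real,K::real set). (Inf K, Sup K))"
    have inj: "inj_on h pN'"
    proof (rule inj_onI)
      fix z w assume zw: "z \<in> pN'" "w \<in> pN'" "h z = h w"
      obtain x K y L where z: "z = (x,K)" and w: "w = (y,L)" by (metis surj_pair)
      have xp: "(x,K) \<in> p" "(y,L) \<in> p" "Inf K < Sup K" using zw by (auto simp: pN'_def z w)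
      have "K = L" using K[OF xp(1)] K[OF xp(2)] zw(3) by (metis fst_conv h_def old.prod.case snd_conv w z)
      show "z = w"
      proof (rule ccontr)
        assume "z \<noteq> w"
        then have "interior K \<inter> interior L = {}" using tagged_division_ofD(5)[OF p xp(1,2)] unfolding z w by simp
        then have "interior {Inf K..Sup K} = {}" using \<open>K = L\<close> K[OF xp(1)] by auto
        then show False using xp(3) by simp
      qed
    qed
    have "(\<Sum>(u,v)\<in>h ` pN'. norm (f v - f u)) < e"
    proof (rule ac0)
      show "finite (h ` pN')" using fin by (auto simp: pN'_def intro: finite_subset[of _ p])
      show "\<forall>(u, v)\<in>h ` pN'. u \<le> v \<and> {u..v} \<subseteq> {a..b}" using K by (fastforce simp: h_def pN'_def)
      show "pairwise (\<lambda>(u, v) (u', v'). {u<..<v} \<inter> {u'<..<v'} = {}) (h ` pN')"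
      proof (rule pairwiseI)
        fix z w assume zw: "z \<in> h ` pN'" "w \<in> h ` pN'" "z \<noteq> w"
        obtain x K where z: "(x,K) \<in> p" "z = (Inf K, Sup K)" using zw(1) by (auto simp: h_def pN'_def)
        obtain y L where w: "(y,L) \<in> p" "w = (Inf L, Sup L)" using zw(2) by (auto simp: h_def pN'_def)
        have "K \<noteq> L" using zw(3) z(2) w(2) by auto
        then have "interior K \<inter> interior L = {}" using tagged_division_ofD(5)[OF p z(1) w(1)] by simp
        then have "{Inf K<..<Sup K} \<inter> {Inf L<..<Sup L} = {}" using K[OF z(1)] K[OF w(1)] by (metis interior_atLeastAtMost_real)
        then show "(\<lambda>(u, v) (u', v'). {u<..<v} \<inter> {u'<..<v'} = {}) z w" by (simp add: z(2) w(2))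
      qed
      have "(\<Sum>(u, v)\<in>h ` pN'. v - u) = (\<Sum>(x,K)\<in>pN'. measure lborel K)"
        unfolding sum.reindex[OF inj] by (intro sum.cong) (auto simp: h_def pN'_def dest!: K)
      also have "\<dots> \<le> (\<Sum>(x,K)\<in>p. measure lborel K *\<^sub>R indicat_real N x)"
        unfolding pN'_def by (rule order_trans[OF _ sum_mono2[OF fin, of pN']]) (auto intro!: sum_mono simp: pN'_def)
      also have "\<dots> < \<delta>" using \<gamma>2[of p] p fine by (simp add: abs_less_iff)
      finally show "(\<Sum>(u, v)\<in>h ` pN'. v - u) < \<delta>0" using \<delta> by simp
    qed
    then have "(\<Sum>(x,K)\<in>pN'. f (Sup K) - f (Inf K)) < e"
      unfolding sum.reindex[OF inj]
      by (rule le_less_trans[rotated]) (auto intro!: sum_mono simp: h_def)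
    also have "(\<Sum>(x,K)\<in>pN'. f (Sup K) - f (Inf K)) = (\<Sum>(x,K)\<in>pN. f (Sup K) - f (Inf K))"
      using fin K by (intro sum.mono_neutral_left) (force simp: pN_def pN'_def intro: finite_subset[of _ p])+
    finally have s1: "(\<Sum>(x,K)\<in>pN. f (Sup K) - f (Inf K)) < e" .
    have "(\<Sum>(x,K)\<in>pN. Sup K - Inf K) = (\<Sum>(x,K)\<in>pN. measure lborel K *\<^sub>R indicat_real N x)"
      using K by (intro sum.cong) (auto simp: pN_def)
    also have "\<dots> = (\<Sum>(x,K)\<in>p. measure lborel K *\<^sub>R indicat_real N x)"
      using fin by (intro sum.mono_neutral_left) (auto simp: pN_def indicator_def split: if_splits)
    also have "\<dots> < \<delta>" using \<gamma>2[of p] p fine by (simp add: abs_less_iff)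
    finally have s2: "(\<Sum>(x,K)\<in>pN. Sup K - Inf K) < \<delta>" .
    have s2': "(\<Sum>(x,K)\<in>pN. Sup K - Inf K) \<ge> 0" using K by (intro sum_nonneg) (auto simp: pN_def)
    have s3: "(\<Sum>(x,K)\<in>p - pN. f (Sup K) - f (Inf K)) \<le> (c + e) * (\<Sum>(x,K)\<in>p - pN. Sup K - Inf K)"
      unfolding sum_distrib_left
    proof (intro sum_mono, clarsimp)
      fix x K assume xp: "(x,K) \<in> p" "(x,K) \<notin> pN"
      then have "x \<notin> N" by (auto simp: pN_def)
      moreover have Kx: "K = {Inf K..Sup K}" "x \<in> K" "K \<subseteq> {a..b}" "Inf K \<le> Sup K" using K[OF xp(1)] by auto
      ultimately have x: "x \<in> {a..b} - N" by auto
      have "K \<subseteq> \<gamma>' x" using fine(2) xp(1) unfolding fine_def by blast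
      then have sub: "K \<subseteq> ball x (d x)" using x by (simp add: \<gamma>'_def)
      have IS: "Inf K \<in> K" "Sup K \<in> K" using Kx by (metis atLeastAtMost_iff order_refl)+
      have "\<bar>Inf K - x\<bar> < d x" "\<bar>Sup K - x\<bar> < d x" using IS sub by (auto simp: dist_real_def abs_minus_commute)
      moreover have "Inf K \<le> x" "x \<le> Sup K" using Kx(1,2) by auto
      ultimately show "f (Sup K) - f (Inf K) \<le> (c + e) * (Sup K - Inf K)"
        using IS Kx by (intro d(2)[OF x]) auto
    qed
    have split: "(\<Sum>z\<in>p. g z) = (\<Sum>z\<in>pN. g z) + (\<Sum>z\<in>p - pN. g z)" for g :: "real \<times> real set \<Rightarrow> real"
      using sum.subset_diff[of pN p g] fin by (simp add: pN_def add.commute subset_iff)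
    have "f b - f a = (\<Sum>(x,K)\<in>p. f (Sup K) - f (Inf K))"
      using additive_tagged_division_1[OF ab p, of f] by simp
    also have "\<dots> \<le> e + (c + e) * (\<Sum>(x,K)\<in>p - pN. Sup K - Inf K)" unfolding split using s1 s3 by linarith
    also have "(\<Sum>(x,K)\<in>p - pN. Sup K - Inf K) = (b - a) - (\<Sum>(x,K)\<in>pN. Sup K - Inf K)"
      using additive_tagged_division_1[OF ab p, of "\<lambda>x. x"] unfolding split by simp
    also have "e + (c + e) * (b - a - (\<Sum>(x,K)\<in>pN. Sup K - Inf K)) \<le> e + (c + e) * (b - a) + \<bar>c\<bar> * \<delta>"
    proof -
      let ?S = "\<Sum>(x,K)\<in>pN. Sup K - Inf K"
      have "- c * ?S \<le> \<bar>c\<bar> * ?S" using s2' by (intro mult_right_mono) auto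
      also have "\<dots> \<le> \<bar>c\<bar> * \<delta>" using s2 by (intro mult_left_mono) auto
      finally have "- c * ?S \<le> \<bar>c\<bar> * \<delta>" .
      moreover have "e * ?S \<ge> 0" using e s2' by simp
      ultimately show ?thesis by (simp add: algebra_simps)
    qed
    finally show ?thesis using c\<delta> by simp
  qed
  show ?thesis
  proof (rule field_le_epsilon)
    fix r :: real assume r: "r > 0"
    define e where "e = r / (b - a + 2)"
    have "e > 0" using r ab by (simp add: e_def)
    moreover have "e * (b - a + 2) = r" using ab by (simp add: e_def)
    ultimately show "f b - f a \<le> c * (b - a) + r" using main[of e] by (simp add: algebra_simps)
  qed
qed

lemma abs_cont_on_subset:
  assumes "abs_cont_on S f" "T \<subseteq> S"
  shows "abs_cont_on T f"
  unfolding abs_cont_on_def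
proof (intro allI impI)
  fix \<epsilon> :: real assume "\<epsilon> > 0"
  then obtain \<delta> where \<delta>: "\<delta> > 0" and *: "\<And>D. finite D \<and> (\<forall>(u,v)\<in>D. u \<le> v \<and> {u..v} \<subseteq> S) \<and>
        pairwise (\<lambda>(u,v) (u',v'). {u<..<v} \<inter> {u'<..<v'} = {}) D \<and>
        (\<Sum>(u,v)\<in>D. v - u) < \<delta> \<Longrightarrow> (\<Sum>(u,v)\<in>D. norm (f v - f u)) < \<epsilon>"
    using assms(1) unfolding abs_cont_on_def by blast
  show "\<exists>\<delta>>0. \<forall>D. finite D \<and> (\<forall>(u,v)\<in>D. u \<le> v \<and> {u..v} \<subseteq> T) \<and>
        pairwise (\<lambda>(u,v) (u',v'). {u<..<v} \<inter> {u'<..<v'} = {}) D \<and>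
        (\<Sum>(u,v)\<in>D. v - u) < \<delta> \<longrightarrow> (\<Sum>(u,v)\<in>D. norm (f v - f u)) < \<epsilon>"
  proof (intro exI[of _ \<delta>] conjI allI impI \<delta>)
    fix D assume D: "finite D \<and> (\<forall>(u,v)\<in>D. u \<le> v \<and> {u..v} \<subseteq> T) \<and>
        pairwise (\<lambda>(u,v) (u',v'). {u<..<v} \<inter> {u'<..<v'} = {}) D \<and> (\<Sum>(u,v)\<in>D. v - u) < \<delta>"
    then have "\<forall>(u,v)\<in>D. u \<le> v \<and> {u..v} \<subseteq> S" using assms(2) by blast
    with D show "(\<Sum>(u,v)\<in>D. norm (f v - f u)) < \<epsilon>" by (intro *) blast
  qed
qed

text \<open>The common tool for Lipschitz images of an absolutely continuous curve, such as
  \<open>V\<close> along a solution; with the identity as \<open>g\<close> it also covers Lipschitz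
  functions.\<close>

lemma abs_cont_on_dominated:
  assumes ac: "abs_cont_on S g"
    and le: "\<And>u v. u \<in> S \<Longrightarrow> v \<in> S \<Longrightarrow> norm (f v - f u) \<le> L * norm (g v - g u)"
  shows "abs_cont_on S f"
  unfolding abs_cont_on_def
proof (intro allI impI)
  fix \<epsilon> :: real assume e: "\<epsilon> > 0"
  \<comment> \<open>\<open>L\<close> carries no sign, so a surely positive divisor takes its
    place.\<close>
  define K where "K = \<bar>L\<bar> + 1"
  have "\<epsilon> / K > 0" using e by (simp add: K_def)
  then obtain \<delta> where \<delta>: "\<delta> > 0" and *: "\<And>D. finite D \<Longrightarrow> (\<forall>(u,v)\<in>D. u \<le> v \<and> {u..v} \<subseteq> S) \<Longrightarrow>
        pairwise (\<lambda>(u,v) (u',v'). {u<..<v} \<inter> {u'<..<v'} = {}) D \<Longrightarrow>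
        (\<Sum>(u,v)\<in>D. v - u) < \<delta> \<Longrightarrow> (\<Sum>(u,v)\<in>D. norm (g v - g u)) < \<epsilon> / K"
    using ac unfolding abs_cont_on_def by meson
  show "\<exists>\<delta>>0. \<forall>D. finite D \<and> (\<forall>(u,v)\<in>D. u \<le> v \<and> {u..v} \<subseteq> S) \<and>
        pairwise (\<lambda>(u,v) (u',v'). {u<..<v} \<inter> {u'<..<v'} = {}) D \<and>
        (\<Sum>(u,v)\<in>D. v - u) < \<delta> \<longrightarrow> (\<Sum>(u,v)\<in>D. norm (f v - f u)) < \<epsilon>"
  proof (intro exI[of _ \<delta>] conjI allI impI \<delta>, elim conjE)
    fix D :: "(real \<times> real) set"
    assume D: "finite D" "\<forall>(u,v)\<in>D. u \<le> v \<and> {u..v} \<subseteq> S"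
        "pairwise (\<lambda>(u,v) (u',v'). {u<..<v} \<inter> {u'<..<v'} = {}) D" "(\<Sum>(u,v)\<in>D. v - u) < \<delta>"
    have "(\<Sum>(u,v)\<in>D. norm (f v - f u)) \<le> (\<Sum>(u,v)\<in>D. K * norm (g v - g u))"
    proof (intro sum_mono, clarify)
      fix u v assume "(u,v) \<in> D"
      then have "u \<in> S" "v \<in> S" using D(2) by force+
      then have "norm (f v - f u) \<le> L * norm (g v - g u)" by (rule le)
      also have "\<dots> \<le> K * norm (g v - g u)" by (intro mult_right_mono) (auto simp: K_def)
      finally show "norm (f v - f u) \<le> K * norm (g v - g u)" .
    qed
    also have "\<dots> = K * (\<Sum>(u,v)\<in>D. norm (g v - g u))" by (simp add: sum_distrib_left case_prod_unfold)
    also have "\<dots> < K * (\<epsilon> / K)" using *[OF D] by (intro mult_strict_left_mono) (auto simp: K_def)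
    also have "\<dots> = \<epsilon>" by (simp add: K_def)
    finally show "(\<Sum>(u,v)\<in>D. norm (f v - f u)) < \<epsilon>" .
  qed
qed

lemma abs_cont_on_ident: "abs_cont_on S (\<lambda>x::real. x)"
  unfolding abs_cont_on_def
proof (intro allI impI)
  fix \<epsilon> :: real assume e: "\<epsilon> > 0"
  have eq: "(\<Sum>(u,v)\<in>D. norm (v - u)) = (\<Sum>(u,v)\<in>D. v - u)" if "\<forall>(u,v)\<in>D. u \<le> v \<and> {u..v} \<subseteq> S" for D
    using that by (intro sum.cong) auto
  show "\<exists>\<delta>>0. \<forall>D. finite D \<and> (\<forall>(u,v)\<in>D. u \<le> v \<and> {u..v} \<subseteq> S) \<and>
        pairwise (\<lambda>(u,v) (u',v'). {u<..<v} \<inter> {u'<..<v'} = {}) D \<and>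
        (\<Sum>(u,v)\<in>D. v - u) < \<delta> \<longrightarrow> (\<Sum>(u,v)\<in>D. norm (v - u)) < \<epsilon>"
    by (rule exI[of _ \<epsilon>]) (use e eq in auto)
qed

lemma Lipschitz_imp_abs_cont_on:
  assumes "\<And>u v. u \<in> S \<Longrightarrow> v \<in> S \<Longrightarrow> norm (f v - f u) \<le> L * \<bar>v - u\<bar>"
  shows "abs_cont_on S f"
  by (rule abs_cont_on_dominated[OF abs_cont_on_ident, where L = L]) (use assms in auto)

lemma abs_cont_on_imp_continuous_on:
  assumes "abs_cont_on {a..b} f"
  shows "continuous_on {a..b} f"
  unfolding continuous_on_iff
proof (intro ballI allI impI)
  fix x \<epsilon> :: real assume x: "x \<in> {a..b}" and "\<epsilon> > 0"
  then obtain \<delta> where \<delta>: "\<delta> > 0" and *: "\<And>D. finite D \<Longrightarrow> (\<forall>(u,v)\<in>D. u \<le> v \<and> {u..v} \<subseteq> {a..b}) \<Longrightarrow>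
        pairwise (\<lambda>(u,v) (u',v'). {u<..<v} \<inter> {u'<..<v'} = {}) D \<Longrightarrow>
        (\<Sum>(u,v)\<in>D. v - u) < \<delta> \<Longrightarrow> (\<Sum>(u,v)\<in>D. norm (f v - f u)) < \<epsilon>"
    using assms unfolding abs_cont_on_def by meson
  show "\<exists>d>0. \<forall>x'\<in>{a..b}. dist x' x < d \<longrightarrow> dist (f x') (f x) < \<epsilon>"
  proof (intro exI[of _ \<delta>] conjI ballI impI \<delta>)
    fix y assume y: "y \<in> {a..b}" "dist y x < \<delta>"
    show "dist (f y) (f x) < \<epsilon>"
      using *[of "{(x, y)}"] *[of "{(y, x)}"] x y
      by (cases "x \<le> y") (auto simp: dist_norm norm_minus_commute pairwise_def)
  qed
qed

text \<open>The vector case reduces to the scalar one by testing against the unit vector along the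
  increment, where the inner product equals the norm.\<close>

lemma abs_cont_norm_increment_le:
  fixes x :: "real \<Rightarrow> 'a::euclidean_space"
  assumes ab: "a \<le> b" and ac: "abs_cont_on {a..b} x" and N: "negligible N"
    and der: "\<And>t. t \<in> {a..b} - N \<Longrightarrow> \<exists>v. (x has_vector_derivative v) (at t within {a..b}) \<and> norm v \<le> M"
  shows "norm (x b - x a) \<le> M * (b - a)"
proof -
  define u where "u = sgn (x b - x a)"
  have u: "norm u \<le> 1" by (simp add: u_def norm_sgn)
  have "x b \<bullet> u - x a \<bullet> u \<le> M * (b - a)"
  proof (rule abs_cont_increment_le[OF ab _ N])
    show "abs_cont_on {a..b} (\<lambda>t. x t \<bullet> u)"
    proof (rule abs_cont_on_dominated[OF ac, where L = 1])
      fix s t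
      have "norm ((x t - x s) \<bullet> u) \<le> norm (x t - x s) * norm u" using Cauchy_Schwarz_ineq2 by simp
      also have "\<dots> \<le> norm (x t - x s) * 1" by (intro mult_left_mono u) auto
      finally show "norm (x t \<bullet> u - x s \<bullet> u) \<le> 1 * norm (x t - x s)" by (simp add: inner_diff_left)
    qed
    fix t assume "t \<in> {a..b} - N"
    then obtain v where v: "(x has_vector_derivative v) (at t within {a..b})" "norm v \<le> M" using der by blast
    have "((\<lambda>t. x t \<bullet> u) has_vector_derivative v \<bullet> u) (at t within {a..b})"
      by (rule bounded_linear.has_vector_derivative[OF bounded_linear_inner_left v(1)])
    moreover have "v \<bullet> u \<le> M"
    proof -
      have "v \<bullet> u \<le> norm v * norm u" by (rule norm_cauchy_schwarz)
      also have "\<dots> \<le> norm v * 1" by (intro mult_left_mono u) auto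
      finally show ?thesis using v(2) by simp
    qed
    ultimately show "\<exists>d\<le>M. ((\<lambda>t. x t \<bullet> u) has_real_derivative d) (at t within {a..b})"
      by (auto simp: has_real_derivative_iff_has_vector_derivative)
  qed
  moreover have "(x b - x a) \<bullet> u = norm (x b - x a)"
    by (cases "x b = x a") (simp_all add: u_def sgn_div_norm inner_commute dot_square_norm power2_eq_square)
  ultimately show ?thesis by (simp add: inner_diff_left)
qed

text \<open>Clamping to \<open>{a..b}\<close> and to \<open>{b..c}\<close> splits each interval of a
  family at \<open>b\<close>. Clamped intervals stay disjoint and are never longer, so each half is
  controlled by its own hypothesis.\<close>

lemma abs_cont_on_combine:
  assumes ac1: "abs_cont_on {a..b} f" and ac2: "abs_cont_on {b..c} f"
  shows "abs_cont_on {a..c} f"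
proof -
  let ?dis = "\<lambda>D. pairwise (\<lambda>(u::real,v) (u',v'). {u<..<v} \<inter> {u'<..<v'} = {}) D"
  have part: "\<exists>\<delta>>0. \<forall>D. finite D \<and> (\<forall>(u,v)\<in>D. u \<le> v \<and> {u..v} \<subseteq> {a..c}) \<and> ?dis D \<and> (\<Sum>(u,v)\<in>D. v - u) < \<delta>
      \<longrightarrow> (\<Sum>(u,v)\<in>D. norm (f (r v) - f (r u))) < \<epsilon>"
    if ac: "abs_cont_on {p..q} f" and e: "\<epsilon> > 0" and pq: "p \<le> q"
    and r: "r = (\<lambda>x. max p (min q x))" for p q \<epsilon> and r :: "real \<Rightarrow> real"
  proof -
    obtain \<delta> where \<delta>: "\<delta> > 0" and *: "\<And>D. finite D \<Longrightarrow> (\<forall>(u,v)\<in>D. u \<le> v \<and> {u..v} \<subseteq> {p..q}) \<Longrightarrow>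
        ?dis D \<Longrightarrow> (\<Sum>(u,v)\<in>D. v - u) < \<delta> \<Longrightarrow> (\<Sum>(u,v)\<in>D. norm (f v - f u)) < \<epsilon>"
      using ac e unfolding abs_cont_on_def by meson
    show ?thesis
    proof (intro exI[of _ \<delta>] conjI allI impI \<delta>, elim conjE)
      fix D :: "(real \<times> real) set"
      assume D: "finite D" "\<forall>(u,v)\<in>D. u \<le> v \<and> {u..v} \<subseteq> {a..c}" "?dis D" "(\<Sum>(u,v)\<in>D. v - u) < \<delta>"
      \<comment> \<open>Several intervals may clamp to the same single point. Removing them makes
        \<open>h\<close> injective, and their terms vanish.\<close>
      define E where "E = {(u,v)\<in>D. r u < r v}"
      define h where "h = map_prod r r"
      have fE: "finite E" and ED: "E \<subseteq> D" using D(1) by (auto simp: E_def intro: finite_subset[of _ D])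
      have sub: "{r u<..<r v} \<subseteq> {u<..<v}" for u v by (auto simp: r min_def max_def split: if_splits)
      have dj: "{r u<..<r v} \<inter> {r u'<..<r v'} = {}" if "(u,v) \<in> D" "(u',v') \<in> D" "(u,v) \<noteq> (u',v')" for u v u' v'
        using D(3) that sub[of u v] sub[of u' v'] unfolding pairwise_def by fast
      have inj: "inj_on h E"
      proof (rule inj_onI)
        fix z w assume zw: "z \<in> E" "w \<in> E" "h z = h w"
        obtain u v u' v' where z: "z = (u,v)" and w: "w = (u',v')" by (metis surj_pair)
        have "r u = r u'" "r v = r v'" "r u < r v" using zw by (auto simp: h_def z w E_def)
        moreover have "(u,v) \<in> D" "(u',v') \<in> D" using zw ED by (auto simp: z w)
        moreover have "(r u + r v) / 2 \<in> {r u<..<r v}" using \<open>r u < r v\<close> by simp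
        ultimately show "z = w" using dj[of u v u' v'] unfolding z w by auto
      qed
      have "(\<Sum>(u,v)\<in>h ` E. norm (f v - f u)) < \<epsilon>"
      proof (rule *)
        show "finite (h ` E)" using fE by simp
        show "\<forall>(u, v)\<in>h ` E. u \<le> v \<and> {u..v} \<subseteq> {p..q}" using pq by (auto simp: h_def E_def r)
        show "?dis (h ` E)"
        proof (rule pairwiseI)
          fix z w assume "z \<in> h ` E" "w \<in> h ` E" "z \<noteq> w"
          then obtain a b where ab: "a \<in> E" "b \<in> E" "z = h a" "w = h b" "a \<noteq> b" by blast
          obtain u v u' v' where "a = (u,v)" "b = (u',v')" by (metis surj_pair)
          then have "(u,v) \<in> D" "z = (r u, r v)" "(u',v') \<in> D" "w = (r u', r v')" "(u,v) \<noteq> (u',v')"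
            using ab ED by (auto simp: h_def)
          then show "(\<lambda>(u, v) (u', v'). {u<..<v} \<inter> {u'<..<v'} = {}) z w" using dj by auto
        qed
        have "(\<Sum>(u, v)\<in>h ` E. v - u) = (\<Sum>(u, v)\<in>E. r v - r u)"
          unfolding sum.reindex[OF inj] by (intro sum.cong) (auto simp: h_def)
        also have "\<dots> \<le> (\<Sum>(u, v)\<in>E. v - u)"
        proof (intro sum_mono, clarify)
          fix u v assume "(u,v) \<in> E"
          then have "u \<le> v" using D(2) ED by auto
          then show "r v - r u \<le> v - u" by (auto simp: r min_def max_def split: if_splits)
        qed
        also have "\<dots> \<le> (\<Sum>(u, v)\<in>D. v - u)" using D(1,2) ED by (intro sum_mono2) auto
        finally show "(\<Sum>(u, v)\<in>h ` E. v - u) < \<delta>" using D(4) by simp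
      qed
      also have "(\<Sum>(u,v)\<in>h ` E. norm (f v - f u)) = (\<Sum>(u,v)\<in>E. norm (f (r v) - f (r u)))"
        unfolding sum.reindex[OF inj] by (intro sum.cong) (auto simp: h_def)
      also have "\<dots> = (\<Sum>(u,v)\<in>D. norm (f (r v) - f (r u)))"
      proof (rule sum.mono_neutral_left[OF D(1) ED], clarify)
        fix u v assume uv: "(u,v) \<in> D" "(u,v) \<notin> E"
        then have "u \<le> v" using D(2) by auto
        then have "r u \<le> r v" by (auto simp: r min_def max_def)
        then have "r u = r v" using uv by (auto simp: E_def)
        then show "norm (f (r v) - f (r u)) = 0" by simp
      qed
      finally show "(\<Sum>(u,v)\<in>D. norm (f (r v) - f (r u))) < \<epsilon>" .
    qed
  qed
  show ?thesis
  proof (cases "a \<le> b \<and> b \<le> c")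
    case False
    then have "{a..c} \<subseteq> {a..b} \<or> {a..c} \<subseteq> {b..c}" by auto
    then show ?thesis using ac1 ac2 abs_cont_on_subset by blast
  next
    case True
    define r1 where "r1 = (\<lambda>x. max a (min b x))"
    define r2 where "r2 = (\<lambda>x. max b (min c x))"
    show ?thesis unfolding abs_cont_on_def
    proof (intro allI impI)
      fix \<epsilon> :: real assume e: "\<epsilon> > 0"
      then have e2: "\<epsilon> / 2 > 0" by simp
      obtain \<delta>1 where \<delta>1: "\<delta>1 > 0" and 1: "\<And>D. finite D \<and> (\<forall>(u,v)\<in>D. u \<le> v \<and> {u..v} \<subseteq> {a..c}) \<and> ?dis D \<and> (\<Sum>(u,v)\<in>D. v - u) < \<delta>1
          \<longrightarrow> (\<Sum>(u,v)\<in>D. norm (f (r1 v) - f (r1 u))) < \<epsilon> / 2"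
        using part[OF ac1 e2 _ r1_def] True by blast
      obtain \<delta>2 where \<delta>2: "\<delta>2 > 0" and 2: "\<And>D. finite D \<and> (\<forall>(u,v)\<in>D. u \<le> v \<and> {u..v} \<subseteq> {a..c}) \<and> ?dis D \<and> (\<Sum>(u,v)\<in>D. v - u) < \<delta>2
          \<longrightarrow> (\<Sum>(u,v)\<in>D. norm (f (r2 v) - f (r2 u))) < \<epsilon> / 2"
        using part[OF ac2 e2 _ r2_def] True by blast
      show "\<exists>\<delta>>0. \<forall>D. finite D \<and> (\<forall>(u,v)\<in>D. u \<le> v \<and> {u..v} \<subseteq> {a..c}) \<and> ?dis D \<and> (\<Sum>(u,v)\<in>D. v - u) < \<delta>
          \<longrightarrow> (\<Sum>(u,v)\<in>D. norm (f v - f u)) < \<epsilon>"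
      proof (intro exI[of _ "min \<delta>1 \<delta>2"] conjI allI impI)
        fix D assume D: "finite D \<and> (\<forall>(u,v)\<in>D. u \<le> v \<and> {u..v} \<subseteq> {a..c}) \<and> ?dis D \<and> (\<Sum>(u,v)\<in>D. v - u) < min \<delta>1 \<delta>2"
        have "(\<Sum>(u,v)\<in>D. norm (f v - f u)) \<le> (\<Sum>(u,v)\<in>D. norm (f (r1 v) - f (r1 u)) + norm (f (r2 v) - f (r2 u)))"
        proof (intro sum_mono, clarify)
          fix u v assume "(u,v) \<in> D"
          then have uv: "u \<le> v" "{u..v} \<subseteq> {a..c}" using D by auto
          then have "a \<le> u" "v \<le> c" by auto
          then have r: "r1 x = (if x \<le> b then x else b)" "r2 x = (if x \<le> b then b else x)" if "x \<in> {u, v}" for x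
            using that uv(1) True by (auto simp: r1_def r2_def)
          have "f v - f u = (f (r1 v) - f (r1 u)) + (f (r2 v) - f (r2 u))"
            using uv(1) by (simp add: r)
          then show "norm (f v - f u) \<le> norm (f (r1 v) - f (r1 u)) + norm (f (r2 v) - f (r2 u))"
            using norm_triangle_ineq by metis
        qed
        also have "\<dots> = (\<Sum>(u,v)\<in>D. norm (f (r1 v) - f (r1 u))) + (\<Sum>(u,v)\<in>D. norm (f (r2 v) - f (r2 u)))"
          by (simp add: sum.distrib case_prod_unfold)
        also have "\<dots> < \<epsilon> / 2 + \<epsilon> / 2" using 1[of D] 2[of D] D by (intro add_strict_mono) auto
        finally show "(\<Sum>(u,v)\<in>D. norm (f v - f u)) < \<epsilon>" by simp
      qed (use \<delta>1 \<delta>2 in auto)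
    qed
  qed
qed

section \<open>Differentiability of Lipschitz functions\<close>

lemma Lipschitz_imp_integral:
  fixes f :: "real \<Rightarrow> real"
  assumes lip: "\<And>s t. \<bar>f s - f t\<bar> \<le> L * \<bar>s - t\<bar>"
  obtains g where "\<And>a b. a \<le> b \<Longrightarrow> (g has_integral (f b - f a)) {a..b}"
proof -
  have L: "L \<ge> 0" using lip[of 0 1] by auto
  \<comment> \<open>The added slope makes \<open>G\<close> bi-Lipschitz, so that \<open>A \<mapsto> |G ` A|\<close> is an absolutely continuous measure
     and \<open>G'\<close> is its Radon-Nikodym density.\<close>
  define G where "G t = f t + (L + 1) * t" for t
  have G: "t - s \<le> G t - G s" "G t - G s \<le> (2 * L + 1) * (t - s)" if "s \<le> t" for s t
    using lip[of s t] that by (auto simp: G_def abs_if algebra_simps split: if_splits)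
  have sm: "strict_mono G" unfolding strict_mono_def
  proof (intro allI impI)
    fix x y :: real assume "x < y" then show "G x < G y" using G(1)[of x y] by linarith
  qed
  have Glip: "\<bar>G s - G t\<bar> \<le> (2 * L + 1) * \<bar>s - t\<bar>" for s t
    using G[of s t] G[of t s] by (cases "s \<le> t") (auto simp: abs_if algebra_simps)
  have cont: "continuous_on UNIV G"
    by (rule lipschitz_on_continuous_on[of "2*L+1"]) (use Glip L in \<open>auto intro!: lipschitz_onI simp: dist_real_def\<close>)
  have surj: "\<exists>t. G t = y" for y
  proof -
    define r where "r = \<bar>y - G 0\<bar>"
    have "G (-r) \<le> y" "y \<le> G r" using G(1)[of "-r" 0] G(1)[of 0 r] by (auto simp: r_def)
    then have "\<exists>t\<ge>-r. t \<le> r \<and> G t = y"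
      by (intro IVT') (auto simp: r_def intro: continuous_on_subset[OF cont])
    then show ?thesis by blast
  qed
  have bij: "bij G" unfolding bij_def surj_def using strict_mono_imp_inj_on[OF sm] surj by metis
  define H where "H = inv G"
  have GH: "G (H y) = y" "H (G y) = y" for y
    using bij by (auto simp: H_def bij_def surj_f_inv_f)
  have "\<bar>H s - H t\<bar> \<le> 1 * \<bar>s - t\<bar>" for s t
    using G(1)[of "H s" "H t"] G(1)[of "H t" "H s"] GH by (cases "H s \<le> H t") (auto simp: abs_if)
  then have "continuous_on UNIV H"
    by (intro lipschitz_on_continuous_on[of 1]) (auto intro!: lipschitz_onI simp: dist_real_def)
  then have Hm: "H \<in> borel_measurable borel" by (rule borel_measurable_continuous_onI)
  define M where "M = distr lborel borel H"
  have eM: "emeasure M A = emeasure lborel (G ` A)" if "A \<in> sets borel" for A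
  proof -
    have "H -` A = G ` A" using GH by (metis (no_types, lifting) H_def bij bij_vimage_eq_inv_image bij_imp_bij_inv inv_inv_eq)
    then show ?thesis unfolding M_def using that Hm by (subst emeasure_distr) auto
  qed
  \<comment> \<open>\<open>M\<close> measures a set by the Lebesgue measure of its image under
    \<open>G\<close>, and a Lipschitz map sends null sets to null sets.\<close>
  have "absolutely_continuous lborel M" unfolding absolutely_continuous_def
  proof
    fix A :: "real set" assume A: "A \<in> null_sets lborel"
    then have "negligible A" by (metis negligible_iff_null_sets null_sets_completionI)
    then have "negligible (G ` A)"
      by (intro negligible_locally_Lipschitz_image) (use Glip in \<open>auto intro!: exI[of _ UNIV] exI[of _ "2*L+1"]\<close>)
    then have "emeasure lebesgue (G ` A) = 0" by (simp add: negligible_iff_null_sets null_sets_def)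
    moreover have "G ` A \<in> sets borel"
    proof -
      have "H -` A \<inter> space borel \<in> sets borel" using Hm A by (intro measurable_sets) (auto simp: null_sets_def)
      moreover have "H -` A = G ` A" using GH by (metis (no_types, lifting) H_def bij bij_vimage_eq_inv_image bij_imp_bij_inv inv_inv_eq)
      ultimately show ?thesis by simp
    qed
    ultimately show "A \<in> null_sets M" using A eM[of A] by (auto simp: null_sets_def M_def)
  qed
  moreover have "sets M = sets lborel" by (simp add: M_def)
  ultimately obtain g0 where g0: "g0 \<in> borel_measurable lborel" "density lborel g0 = M"
    using sigma_finite_measure.Radon_Nikodym[OF sigma_finite_lborel] by blast
  define g where "g x = enn2real (g0 x)" for x
  have "((\<lambda>x. g x - (L + 1)) has_integral (f b - f a)) {a..b}" if ab: "a \<le> b" for a b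
  proof -
    have img: "G ` {a..b} = {G a..G b}"
    proof safe
      fix x assume "x \<in> {a..b}" then show "G x \<in> {G a..G b}" using sm by (auto simp: strict_mono_less_eq)
    next
      fix y assume "y \<in> {G a..G b}"
      then have "H y \<in> {a..b}" using sm GH by (metis atLeastAtMost_iff strict_mono_less_eq)
      then show "y \<in> G ` {a..b}" using GH by (metis image_eqI)
    qed
    have Gab: "G a \<le> G b" using sm ab by (simp add: strict_mono_less_eq)
    have eq: "(\<integral>\<^sup>+x. g0 x * indicator {a..b} x \<partial>lborel) = ennreal (G b - G a)"
    proof -
      have "emeasure (density lborel g0) {a..b} = ennreal (G b - G a)"
        unfolding g0(2) using eM[of "{a..b}"] Gab by (simp add: img)
      then show ?thesis using g0(1) by (subst (asm) emeasure_density) auto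
    qed
    then have "(\<integral>\<^sup>+x. g0 x * indicator {a..b} x \<partial>lborel) \<noteq> \<infinity>" by simp
    \<comment> \<open>A finite integral makes \<open>g0\<close> finite almost everywhere on the
      interval, so passing to the real function \<open>g\<close> changes no integral.\<close>
    then have "AE x in lborel. g0 x * indicator {a..b} x \<noteq> \<infinity>"
      using g0 by (intro nn_integral_PInf_AE) auto
    then have "(\<integral>\<^sup>+x. ennreal (g x * indicator {a..b} x) \<partial>lborel) = (\<integral>\<^sup>+x. g0 x * indicator {a..b} x \<partial>lborel)"
      by (intro nn_integral_cong_AE) (auto simp: g_def indicator_def top.not_eq_extremum elim!: eventually_mono)
    with eq have "(\<integral>\<^sup>+x. ennreal (g x * indicator {a..b} x) \<partial>lborel) = ennreal (G b - G a)" by simp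
    then have "((\<lambda>x. g x * indicator {a..b} x) has_integral (G b - G a)) UNIV"
      using g0(1) Gab by (intro nn_integral_has_integral) (auto simp: g_def)
    then have "(g has_integral (G b - G a)) {a..b}"
      unfolding has_integral_restrict_UNIV[symmetric, where s = "{a..b}" and f = g] by (rule has_integral_eq[rotated]) (auto simp: indicator_def)
    \<comment> \<open>Subtracting the slope \<open>L + 1\<close> that was added in \<open>G\<close>
      returns to \<open>f\<close>.\<close>
    from has_integral_diff[OF this has_integral_const_real[of "L+1" a b]]
    show ?thesis using ab by (simp add: G_def algebra_simps)
  qed
  then show thesis using that by blast
qed

text \<open>Lebesgue differentiation is applied to intervals \<open>{x..x+h}\<close>, which gives
  the right derivative of the integral of \<open>g\<close>. Applied to the reflected density
  \<open>g (- x)\<close> it gives the left derivative.\<close>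

lemma Lipschitz_differentiable_ae:
  fixes f :: "real \<Rightarrow> real"
  assumes lip: "\<And>s t. \<bar>f s - f t\<bar> \<le> L * \<bar>s - t\<bar>"
  obtains N where "negligible N" "\<And>t. t \<notin> N \<Longrightarrow> \<exists>d. (f has_real_derivative d) (at t)"
proof -
  obtain g where g: "\<And>a b. a \<le> b \<Longrightarrow> (g has_integral (f b - f a)) {a..b}"
    using Lipschitz_imp_integral[OF lip] by blast
  have gr: "((\<lambda>x. g (- x)) has_integral (f (-a) - f (-b))) {a..b}" if "a \<le> b" for a b
    using g[of "-b" "-a"] that has_integral_reflect_real[where f = "\<lambda>x. g (-x)" and i = "f (-a) - f (-b)" and a=a and b=b] by simp
  have "g integrable_on cbox a b" for a b
    by (cases "a \<le> b") (use g in \<open>auto simp: integrable_on_def\<close>)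
  then obtain N1 where N1: "negligible N1" and D1: "\<And>x e. \<lbrakk>x \<notin> N1; 0 < e\<rbrakk> \<Longrightarrow>
               \<exists>d>0. \<forall>h. 0 < h \<and> h < d \<longrightarrow>
                         norm(integral (cbox x (x + h *\<^sub>R One)) g /\<^sub>R h ^ DIM(real) - g x) < e"
    using integrable_ccontinuous_explicit[of g] by blast
  have "(\<lambda>x. g (-x)) integrable_on cbox a b" for a b
    by (cases "a \<le> b") (use gr in \<open>auto simp: integrable_on_def\<close>)
  then obtain N2 where N2: "negligible N2" and D2: "\<And>x e. \<lbrakk>x \<notin> N2; 0 < e\<rbrakk> \<Longrightarrow>
               \<exists>d>0. \<forall>h. 0 < h \<and> h < d \<longrightarrow>
                         norm(integral (cbox x (x + h *\<^sub>R One)) (\<lambda>x. g (-x)) /\<^sub>R h ^ DIM(real) - g (-x)) < e"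
    using integrable_ccontinuous_explicit[of "\<lambda>x. g (-x)"] by blast
  have "negligible (uminus ` N2)" using N2 by (intro negligible_locally_Lipschitz_image) (auto intro!: exI[of _ "UNIV :: real set"] exI[of _ "1::real"] simp: abs_minus_commute)
  then have "negligible (N1 \<union> uminus ` N2)" using N1 by simp
  moreover have "(f has_real_derivative g t) (at t)" if t: "t \<notin> N1 \<union> uminus ` N2" for t
  proof -
    have tN: "t \<notin> N1" "- t \<notin> N2" using t by (auto simp: image_iff)
    show ?thesis unfolding DERIV_def LIM_def dist_real_def
    proof (intro allI impI)
      fix e :: real assume e: "e > 0"
      obtain d1 where d1: "d1 > 0" "\<And>h. 0 < h \<Longrightarrow> h < d1 \<Longrightarrow> norm(integral {t..t+h} g / h - g t) < e"
        using D1[OF tN(1) e] by (auto simp: divide_inverse_commute)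
      obtain d2 where d2: "d2 > 0" "\<And>h. 0 < h \<Longrightarrow> h < d2 \<Longrightarrow> norm(integral {-t..-t+h} (\<lambda>x. g (-x)) / h - g t) < e"
        using D2[OF tN(2) e] by (auto simp: divide_inverse_commute)
      show "\<exists>s>0. \<forall>x. x \<noteq> 0 \<and> \<bar>x - 0\<bar> < s \<longrightarrow> \<bar>(f (t + x) - f t) / x - g t\<bar> < e"
      proof (intro exI[of _ "min d1 d2"] conjI allI impI)
        fix h assume h: "h \<noteq> 0 \<and> \<bar>h - 0\<bar> < min d1 d2"
        show "\<bar>(f (t + h) - f t) / h - g t\<bar> < e"
        proof (cases "h > 0")
          case True
          have "integral {t..t+h} g = f (t + h) - f t" using g[of t "t+h"] True by (simp add: integral_unique)
          then show ?thesis using d1(2)[of h] True h by simp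
        next
          case False
          have "integral {-t..-t+(-h)} (\<lambda>x. g (-x)) = f t - f (t + h)" using gr[of "-t" "-t+(-h)"] False h by (simp add: integral_unique add.commute)
          moreover have "(f t - f (t + h)) / (- h) = (f (t + h) - f t) / h" using h by (simp add: field_simps)
          ultimately show ?thesis using d2(2)[of "-h"] False h by simp
        qed
      qed (use d1 d2 in auto)
    qed
  qed
  ultimately show thesis using that by blast
qed

lemma Lipschitz_vector_differentiable_ae:
  fixes x :: "real \<Rightarrow> 'a::euclidean_space"
  assumes lip: "\<And>s t. norm (x s - x t) \<le> L * \<bar>s - t\<bar>"
  obtains N where "negligible N" "\<And>t. t \<notin> N \<Longrightarrow> \<exists>v. (x has_vector_derivative v) (at t)"
proof -
  have "\<exists>N. negligible N \<and> (\<forall>t. t \<notin> N \<longrightarrow> (\<exists>d. ((\<lambda>t. x t \<bullet> b) has_real_derivative d) (at t)))" if "b \<in> Basis" for b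
  proof -
    have "\<bar>x s \<bullet> b - x t \<bullet> b\<bar> \<le> L * \<bar>s - t\<bar>" for s t
      using Basis_le_norm[OF that, of "x s - x t"] lip[of s t] by (simp add: inner_diff_left)
    then obtain N where "negligible N" "\<And>t. t \<notin> N \<Longrightarrow> \<exists>d. ((\<lambda>t. x t \<bullet> b) has_real_derivative d) (at t)"
      using Lipschitz_differentiable_ae[of "\<lambda>t. x t \<bullet> b" L] by blast
    then show ?thesis by blast
  qed
  then have "\<forall>b\<in>Basis. \<exists>N. negligible N \<and> (\<forall>t. t \<notin> N \<longrightarrow> (\<exists>d. ((\<lambda>t. x t \<bullet> b) has_real_derivative d) (at t)))"
    by blast
  then obtain N where N: "\<And>b. b \<in> Basis \<Longrightarrow> negligible (N b)"
    "\<And>b t. b \<in> Basis \<Longrightarrow> t \<notin> N b \<Longrightarrow> \<exists>d. ((\<lambda>t. x t \<bullet> b) has_real_derivative d) (at t)"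
    using bchoice[of Basis "\<lambda>b N. negligible N \<and> (\<forall>t. t \<notin> N \<longrightarrow> (\<exists>d. ((\<lambda>t. x t \<bullet> b) has_real_derivative d) (at t)))"] by blast
  show thesis
  proof (rule that[of "\<Union>(N ` Basis)"])
    show "negligible (\<Union>(N ` Basis))" using N(1) by (intro negligible_Union) auto
    fix t assume t: "t \<notin> \<Union>(N ` Basis)"
    then obtain d where d: "\<And>b. b \<in> Basis \<Longrightarrow> ((\<lambda>t. x t \<bullet> b) has_real_derivative d b) (at t)"
      using N(2) bchoice[of Basis "\<lambda>b d. ((\<lambda>t. x t \<bullet> b) has_real_derivative d) (at t)"] by blast
    have "(x has_vector_derivative (\<Sum>b\<in>Basis. d b *\<^sub>R b)) (at t)"
      unfolding has_vector_derivative_def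
    proof (subst has_derivative_componentwise_within, intro ballI)
      fix b :: 'a assume b: "b \<in> Basis"
      then have "(\<lambda>y. (y *\<^sub>R (\<Sum>b\<in>Basis. d b *\<^sub>R b)) \<bullet> b) = (\<lambda>y. d b * y)"
        by (simp add: fun_eq_iff inner_sum_left inner_Basis if_distrib cong: if_cong)
      then show "((\<lambda>t. x t \<bullet> b) has_derivative (\<lambda>y. (y *\<^sub>R (\<Sum>b\<in>Basis. d b *\<^sub>R b)) \<bullet> b)) (at t)"
        using d[OF b] by (simp only: has_field_derivative_def)
    qed
    then show "\<exists>v. (x has_vector_derivative v) (at t)" by blast
  qed
qed

text \<open>An Ascoli argument for functions that may jump, by an amount controlled by
  \<open>h n\<close>: a diagonal subsequence converges at the rationals, near-equicontinuity carries
  this to every real, and the vanishing error leaves a Lipschitz limit.\<close>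

lemma almost_Lipschitz_subsequence:
  fixes X :: "nat \<Rightarrow> real \<Rightarrow> 'a::euclidean_space"
  assumes lip: "\<And>n s t. norm (X n s - X n t) \<le> M * (\<bar>s - t\<bar> + h n)"
    and h: "h \<longlonglongrightarrow> 0" and bdd: "\<And>n t. norm (X n t) \<le> K"
  obtains k x where "strict_mono (k :: nat \<Rightarrow> nat)" "\<And>t. (\<lambda>n. X (k n) t) \<longlonglongrightarrow> x t"
    "\<And>s t. norm (x s - x t) \<le> M * \<bar>s - t\<bar>"
proof -
  obtain k :: "nat \<Rightarrow> nat" where k: "strict_mono k" "\<And>q. q \<in> \<rat> \<Longrightarrow> \<exists>l. (\<lambda>n. X (k n) q) \<longlonglongrightarrow> l"
    using function_convergent_subsequence[OF countable_rat, of X K] bdd by blast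
  have hk: "(\<lambda>n. h (k n)) \<longlonglongrightarrow> 0" using LIMSEQ_subseq_LIMSEQ[OF h k(1)] by (simp add: o_def)
  have "convergent (\<lambda>n. X (k n) t)" for t
    unfolding Cauchy_convergent_iff[symmetric]
  proof (rule metric_CauchyI)
    fix e :: real assume e: "e > 0"
    define M' where "M' = \<bar>M\<bar> + 1"
    have M': "M' > 0" "M \<le> M'" by (auto simp: M'_def)
    \<comment> \<open>The distance to \<open>q\<close> and the defect \<open>h\<close> each cost at
      most \<open>e / 8\<close>. Two errors of \<open>e / 4\<close> at \<open>t\<close> and the
      Cauchy error \<open>e / 2\<close> at \<open>q\<close> then add up to \<open>e\<close>.\<close>
    have "e / (8 * M') > 0" using e M' by simp
    then obtain q where q: "q \<in> \<rat>" "t < q" "q < t + e / (8 * M')"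
      using Rats_dense_in_real[of t "t + e / (8 * M')"] by auto
    have "eventually (\<lambda>n. \<bar>h (k n)\<bar> < e / (8 * M')) sequentially"
      using tendstoD[OF hk, of "e / (8 * M')"] e M' by simp
    then obtain n1 where n1: "\<And>n. n \<ge> n1 \<Longrightarrow> \<bar>h (k n)\<bar> < e / (8 * M')" by (auto simp: eventually_sequentially)
    have "Cauchy (\<lambda>n. X (k n) q)" using k(2)[OF q(1)] LIMSEQ_imp_Cauchy by blast
    then obtain n2 where n2: "\<And>m n. m \<ge> n2 \<Longrightarrow> n \<ge> n2 \<Longrightarrow> dist (X (k m) q) (X (k n) q) < e / 2"
      using e unfolding Cauchy_def by (meson half_gt_zero)
    have near: "dist (X (k n) t) (X (k n) q) < e / 4" if "n \<ge> n1" for n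
    proof -
      have "dist (X (k n) t) (X (k n) q) \<le> M * (\<bar>t - q\<bar> + h (k n))" unfolding dist_norm by (rule lip)
      also have "\<dots> \<le> \<bar>M * (\<bar>t - q\<bar> + h (k n))\<bar>" by simp
      also have "\<dots> \<le> M' * (\<bar>t - q\<bar> + \<bar>h (k n)\<bar>)" unfolding abs_mult by (intro mult_mono) (auto simp: M'_def)
      also have "\<dots> < M' * (e / (8 * M') + e / (8 * M'))" using n1[OF that] q M' by (intro mult_strict_left_mono) auto
      also have "\<dots> = e / 4" using M' by (simp add: field_simps)
      finally show ?thesis .
    qed
    show "\<exists>M. \<forall>m\<ge>M. \<forall>n\<ge>M. dist (X (k m) t) (X (k n) t) < e"
    proof (intro exI[of _ "max n1 n2"] allI impI)
      fix m n assume mn: "m \<ge> max n1 n2" "n \<ge> max n1 n2"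
      have "dist (X (k m) t) (X (k n) t) \<le> dist (X (k m) t) (X (k m) q) + dist (X (k m) q) (X (k n) q) + dist (X (k n) q) (X (k n) t)"
        using dist_triangle[of "X (k m) t" "X (k n) t" "X (k m) q"]
          dist_triangle[of "X (k m) q" "X (k n) t" "X (k n) q"] by linarith
      then show "dist (X (k m) t) (X (k n) t) < e"
        using near[of m] near[of n] n2[of m n] mn by (simp add: dist_commute)
    qed
  qed
  then obtain x where x: "\<And>t. (\<lambda>n. X (k n) t) \<longlonglongrightarrow> x t" unfolding convergent_def using choice[of "\<lambda>t l. (\<lambda>n. X (k n) t) \<longlonglongrightarrow> l"] by blast
  have "norm (x s - x t) \<le> M * \<bar>s - t\<bar>" for s t
  proof (rule LIMSEQ_le)
    show "(\<lambda>n. norm (X (k n) s - X (k n) t)) \<longlonglongrightarrow> norm (x s - x t)" by (intro tendsto_intros x)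
    have "(\<lambda>n. M * (\<bar>s - t\<bar> + h (k n))) \<longlonglongrightarrow> M * (\<bar>s - t\<bar> + 0)" by (intro tendsto_intros hk)
    then show "(\<lambda>n. M * (\<bar>s - t\<bar> + h (k n))) \<longlonglongrightarrow> M * \<bar>s - t\<bar>" by simp
    show "\<exists>n0. \<forall>n\<ge>n0. norm (X (k n) s - X (k n) t) \<le> M * (\<bar>s - t\<bar> + h (k n))" using lip by blast
  qed
  with k(1) x show thesis using that by blast
qed

section \<open>Local solutions by Euler polygons\<close>

primrec euler :: "('a::real_vector \<Rightarrow> 'a) \<Rightarrow> 'a \<Rightarrow> real \<Rightarrow> nat \<Rightarrow> 'a" where
  "euler f x0 h 0 = x0"
| "euler f x0 h (Suc j) = euler f x0 h j + h *\<^sub>R f (euler f x0 h j)"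

lemma euler_diff:
  "l \<le> m \<Longrightarrow> euler f x0 h m - euler f x0 h l = (\<Sum>j\<in>{l..<m}. h *\<^sub>R f (euler f x0 h j))"
proof (induction m)
  case (Suc m)
  show ?case
  proof (cases "l = Suc m")
    case False
    then have "l \<le> m" using Suc.prems by simp
    then show ?thesis using Suc.IH by (simp add: algebra_simps)
  qed simp
qed simp

text \<open>\<open>sep\<close> stands for upper semicontinuity with closed convex values, expressed
  through \<open>f\<close>: near \<open>x\<close> the field stays in a half-space that excludes
  \<open>v\<close>. Taking \<open>v = f x\<close> shows that it forces \<open>f x \<in> G x\<close>,
  although \<open>f\<close> may jump.\<close>

lemma local_solution_exists:
  fixes f :: "'a::euclidean_space \<Rightarrow> 'a" and G :: "'a \<Rightarrow> 'a set"
  assumes bdd: "\<And>z. dist z x0 \<le> 1 \<Longrightarrow> norm (f z) \<le> M"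
    and sep: "\<And>x v. v \<notin> G x \<Longrightarrow> \<exists>a c \<rho>. \<rho> > 0 \<and> a \<bullet> v > c \<and> (\<forall>z\<in>ball x \<rho>. a \<bullet> f z \<le> c)"
  obtains \<tau> x N L where "\<tau> > 0" "x 0 = x0" "\<And>s t. norm (x s - x t) \<le> L * \<bar>s - t\<bar>" "negligible N"
    "\<And>t. t \<in> {0<..<\<tau>} - N \<Longrightarrow> \<exists>v. (x has_vector_derivative v) (at t) \<and> v \<in> G (x t)"
proof -
  define M' where "M' = max M 1"
  \<comment> \<open>Truncation bounds the field everywhere, so that the Euler nodes need no exit
    time. Up to time \<tau> the limit stays well inside the ball where \<open>f'\<close> agrees with
    \<open>f\<close>.\<close>
  define f' where "f' z = (if dist z x0 \<le> 1 then f z else 0)" for z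
  have M': "M' \<ge> 1" by (simp add: M'_def)
  have f': "norm (f' z) \<le> M'" for z using bdd[of z] by (auto simp: f'_def M'_def)
  define h where "h n = 1 / real (Suc n)" for n
  have h: "h n > 0" "h n \<le> 1" for n by (auto simp: h_def divide_simps)
  have h0: "h \<longlonglongrightarrow> 0" unfolding h_def by (rule LIMSEQ_Suc[OF lim_1_over_n])
  \<comment> \<open>\<open>X n\<close> is the step function through the Euler nodes on \<open>[0, 1]\<close>; it is Lipschitz only up to \<open>h n\<close>.\<close>
  define clip where "clip t = max 0 (min 1 t)" for t :: real
  define Z where "Z n = euler f' x0 (h n)" for n
  define idx where "idx n t = nat \<lfloor>clip t / h n\<rfloor>" for n t
  define X where "X n t = Z n (idx n t)" for n t
  have Zlip: "norm (Z n m - Z n l) \<le> M' * (h n * real (m - l))" if "l \<le> m" for n m l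
  proof -
    have "norm (Z n m - Z n l) \<le> (\<Sum>j\<in>{l..<m}. h n * M')"
      unfolding Z_def euler_diff[OF that] using h[of n] f' by (intro sum_norm_le) (auto intro!: mult_left_mono)
    then show ?thesis by (simp add: algebra_simps)
  qed
  have idx: "real (idx n t) * h n \<le> clip t" "clip t \<le> real (idx n t) * h n + h n" for n t
  proof -
    have "clip t / h n \<ge> 0" using h[of n] by (simp add: clip_def)
    then have "real (idx n t) \<le> clip t / h n" "clip t / h n \<le> real (idx n t) + 1"
      unfolding idx_def by linarith+
    then show "real (idx n t) * h n \<le> clip t" "clip t \<le> real (idx n t) * h n + h n"
      using h[of n] by (simp_all add: field_simps)
  qed
  have idx_mono: "idx n s \<le> idx n t" if "s \<le> t" for n s t
    unfolding idx_def using that h[of n] by (intro nat_mono floor_mono divide_right_mono) (auto simp: clip_def)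
  \<comment> \<open>Nodes count whole steps, so time elapsed on the grid and clipped time elapsed
    differ by at most one step.\<close>
  have idx_diff: "\<bar>h n * real (idx n t - idx n s) - (clip t - clip s)\<bar> \<le> h n" if "s \<le> t" for n s t
    using idx[where n=n and t=t] idx[where n=n and t=s] idx_mono[OF that, of n] by (simp add: of_nat_diff abs_le_iff algebra_simps)
  have clip_diff: "clip t - clip s \<le> t - s" if "s \<le> t" for s t
    using that by (auto simp: clip_def min_def max_def)
  have Xlip1: "norm (X n t - X n s) \<le> M' * (\<bar>s - t\<bar> + h n)" if "s \<le> t" for n s t
  proof -
    have "norm (X n t - X n s) \<le> M' * (h n * real (idx n t - idx n s))"
      unfolding X_def by (rule Zlip[OF idx_mono[OF that]])
    also have "\<dots> \<le> M' * (\<bar>s - t\<bar> + h n)"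
      using idx_diff[OF that, of n] clip_diff[OF that] M' that by (intro mult_left_mono) auto
    finally show ?thesis .
  qed
  have Xlip: "norm (X n s - X n t) \<le> M' * (\<bar>s - t\<bar> + h n)" for n s t
    using Xlip1[where s=s and t=t and n=n] Xlip1[where s=t and t=s and n=n] by (cases "s \<le> t") (auto simp: norm_minus_commute abs_minus_commute)
  have Xbdd: "norm (X n t) \<le> norm x0 + M'" for n t
  proof -
    have "norm (Z n (idx n t) - Z n 0) \<le> M' * (h n * real (idx n t - 0))" by (rule Zlip) simp
    also have "\<dots> \<le> M' * 1" using idx(1)[where n=n and t=t] M' by (intro mult_left_mono) (auto simp: clip_def mult.commute)
    finally have "norm (X n t - x0) \<le> M'" by (simp add: X_def Z_def)
    then show ?thesis using norm_triangle_ineq2[of "X n t" x0] by linarith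
  qed
  obtain k x where k: "strict_mono (k :: nat \<Rightarrow> nat)" and lim: "\<And>t. (\<lambda>n. X (k n) t) \<longlonglongrightarrow> x t"
    and xlip: "\<And>s t. norm (x s - x t) \<le> M' * \<bar>s - t\<bar>"
    using almost_Lipschitz_subsequence[OF Xlip h0 Xbdd] by blast
  have hk: "(\<lambda>n. h (k n)) \<longlonglongrightarrow> 0" using LIMSEQ_subseq_LIMSEQ[OF h0 k(1)] by (simp add: o_def)
  have x0: "x 0 = x0"
  proof (rule LIMSEQ_unique[OF lim])
    show "(\<lambda>n. X (k n) 0) \<longlonglongrightarrow> x0" by (simp add: X_def idx_def clip_def Z_def)
  qed
  \<comment> \<open>By time \<tau> the limit has moved at most 1/2 away from \<open>x0\<close>. With
    \<rho> also at most 1/2, the \<rho>-ball around it stays where the truncation is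
    inactive.\<close>
  define \<tau> where "\<tau> = 1 / (2 * M')"
  have \<tau>: "\<tau> > 0" "\<tau> \<le> 1/2" "M' * \<tau> = 1/2" using M' by (auto simp: \<tau>_def divide_simps)
  have inG: "v \<in> G (x t)" if t: "t \<in> {0<..<\<tau>}" and v: "(x has_vector_derivative v) (at t)" for t v
  proof (rule ccontr)
    assume "v \<notin> G (x t)"
    then obtain a c \<rho>0 where \<rho>0: "\<rho>0 > 0" "a \<bullet> v > c" "\<And>z. z \<in> ball (x t) \<rho>0 \<Longrightarrow> a \<bullet> f z \<le> c"
      using sep by meson
    define \<rho> where "\<rho> = min \<rho>0 (1/2)"
    have "norm (x t - x0) \<le> M' * \<bar>t - 0\<bar>" using xlip[of t 0] x0 by simp
    also have "\<dots> \<le> M' * \<tau>" using t M' by (intro mult_left_mono) auto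
    finally have xt: "dist (x t) x0 \<le> 1/2" using \<tau> by (simp add: dist_norm)
    have \<rho>: "\<rho> > 0" "\<And>z. dist z (x t) < \<rho> \<Longrightarrow> a \<bullet> f' z \<le> c"
    proof -
      show "\<rho> > 0" using \<rho>0 by (simp add: \<rho>_def)
      fix z assume z: "dist z (x t) < \<rho>"
      then have "dist z x0 \<le> 1" using dist_triangle[of z x0 "x t"] xt by (simp add: \<rho>_def)
      then show "a \<bullet> f' z \<le> c" using \<rho>0(3)[of z] z by (simp add: f'_def \<rho>_def dist_commute)
    qed
    \<comment> \<open>Distance budget for the nodes between times \<open>t\<close> and
      \<open>s\<close>: \<rho>/4 for elapsed time, \<rho>/4 for one grid step, \<rho>/4 for the gap
      between \<open>X (k n) t\<close> and \<open>x t\<close>. All these Euler velocities obey the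
      half-space bound, and summing them bounds the increment.\<close>
    have inc: "a \<bullet> (x s - x t) \<le> c * (s - t)" if s: "t \<le> s" "s \<le> 1" "M' * (s - t) < \<rho> / 4" for s
    proof -
      have "eventually (\<lambda>n. dist (X (k n) t) (x t) < \<rho> / 4) sequentially"
        using tendstoD[OF lim, of "\<rho>/4" t] \<rho> by simp
      moreover have "eventually (\<lambda>n. dist (h (k n)) 0 < \<rho> / (4 * M')) sequentially"
        using tendstoD[OF hk, of "\<rho> / (4 * M')"] \<rho>(1) M' by simp
      ultimately have "eventually (\<lambda>n. a \<bullet> (X (k n) s - X (k n) t) \<le> c * (s - t) + \<bar>c\<bar> * h (k n)) sequentially"
      proof eventually_elim
        case (elim n)
        let ?n = "k n"
        have hM: "M' * h ?n < \<rho> / 4" using elim(2) h[of ?n] M' by (simp add: field_simps)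
        let ?l = "idx ?n t" and ?m = "idx ?n s"
        have lm: "?l \<le> ?m" using idx_mono s by blast
        have cl: "clip s = s" "clip t = t" using s t by (auto simp: clip_def)
        have step: "a \<bullet> f' (Z ?n j) \<le> c" if j: "j \<in> {?l..<?m}" for j
        proof (rule \<rho>(2))
          have "norm (Z ?n j - X ?n t) \<le> M' * (h ?n * real (j - ?l))" unfolding X_def using j by (intro Zlip) auto
          also have "\<dots> \<le> M' * (h ?n * real (?m - ?l))" using j M' h[of ?n] by (intro mult_left_mono) auto
          also have "\<dots> \<le> M' * ((s - t) + h ?n)" using idx_diff[OF s(1), of ?n] cl M' by (intro mult_left_mono) auto
          also have "\<dots> < \<rho> / 4 + \<rho> / 4" using s(3) hM by (simp add: algebra_simps)
          finally have "dist (Z ?n j) (X ?n t) < \<rho> / 2" by (simp add: dist_norm)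
          then show "dist (Z ?n j) (x t) < \<rho>" using \<rho>(1) elim(1) dist_triangle[of "Z ?n j" "x t" "X ?n t"] by linarith
        qed
        have "a \<bullet> (X ?n s - X ?n t) = (\<Sum>j\<in>{?l..<?m}. h ?n * (a \<bullet> f' (Z ?n j)))"
          unfolding X_def Z_def euler_diff[OF lm] by (simp add: inner_sum_right)
        also have "\<dots> \<le> (\<Sum>j\<in>{?l..<?m}. h ?n * c)" using step h[of ?n] by (intro sum_mono mult_left_mono) auto
        also have "\<dots> = c * (h ?n * real (?m - ?l))" by simp
        also have "\<dots> \<le> c * (s - t) + \<bar>c\<bar> * h ?n"
        proof -
          have "c * (h ?n * real (?m - ?l) - (s - t)) \<le> \<bar>c\<bar> * \<bar>h ?n * real (?m - ?l) - (s - t)\<bar>"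
            unfolding abs_mult[symmetric] by (rule abs_ge_self)
          also have "\<dots> \<le> \<bar>c\<bar> * h ?n" using idx_diff[OF s(1), of ?n] cl by (intro mult_left_mono) auto
          finally show ?thesis by (simp add: algebra_simps)
        qed
        finally show ?case .
      qed
      moreover have "(\<lambda>n. a \<bullet> (X (k n) s - X (k n) t)) \<longlonglongrightarrow> a \<bullet> (x s - x t)" by (intro tendsto_intros lim)
      moreover have "(\<lambda>n. c * (s - t) + \<bar>c\<bar> * h (k n)) \<longlonglongrightarrow> c * (s - t) + \<bar>c\<bar> * 0" by (intro tendsto_intros hk)
      ultimately have "a \<bullet> (x s - x t) \<le> c * (s - t) + \<bar>c\<bar> * 0"
        by (intro tendsto_le[OF trivial_limit_sequentially])
      then show ?thesis by simp
    qed
    \<comment> \<open>The derivative of \<open>g\<close> at \<open>t\<close> is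
      \<open>a \<bullet> v - c > 0\<close>, whereas the increment bound keeps \<open>g\<close> at or
      below \<open>g t\<close> just after \<open>t\<close>.\<close>
    define g where "g s = a \<bullet> x s - c * s" for s
    have "((\<lambda>s. a \<bullet> x s) has_vector_derivative a \<bullet> v) (at t)"
      by (rule bounded_linear.has_vector_derivative[OF bounded_linear_inner_right v])
    then have "(g has_real_derivative (a \<bullet> v - c)) (at t)"
      unfolding g_def has_real_derivative_iff_has_vector_derivative[symmetric] by (auto intro!: derivative_eq_intros)
    then obtain d where d: "d > 0" "\<And>e. e > 0 \<Longrightarrow> e < d \<Longrightarrow> g t < g (t + e)"
      using DERIV_pos_inc_right[of g "a \<bullet> v - c" t] \<rho>0(2) by auto
    define e where "e = min (d/2) (min (1/2) (\<rho> / (8 * M')))"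
    have e: "e > 0" "e < d" "e \<le> 1/2" "e \<le> \<rho> / (8 * M')" using d(1) \<rho>(1) M' by (auto simp: e_def)
    have "M' * e \<le> M' * (\<rho> / (8 * M'))" using e M' by (intro mult_left_mono) auto
    also have "\<dots> < \<rho> / 4" using M' \<rho>(1) by simp
    finally have "a \<bullet> (x (t + e) - x t) \<le> c * (t + e - t)" using e t \<tau> by (intro inc) auto
    then have "g (t + e) \<le> g t" by (simp add: g_def inner_diff_right algebra_simps)
    then show False using d(2)[of e] e by simp
  qed
  obtain N where N: "negligible N" "\<And>t. t \<notin> N \<Longrightarrow> \<exists>v. (x has_vector_derivative v) (at t)"
    using Lipschitz_vector_differentiable_ae[OF xlip] by blast
  show thesis
    by (rule that[OF \<tau>(1) x0 xlip N(1)]) (use N(2) inG in blast)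
qed

section \<open>Piecewise continuous nonlinearities and their regularization\<close>

text \<open>One-sided limits bound \<open>f\<close> near each point, and bisection turns the local
  bounds into one on the compact interval.\<close>

lemma piecewise_continuous_bounded:
  assumes f: "piecewise_continuous f"
  obtains M where "M \<ge> 0" "\<And>s. s \<in> {a..b} \<Longrightarrow> \<bar>f s\<bar> \<le> M"
proof (cases "a \<le> b")
  case True
  then have "\<exists>M. \<forall>s\<in>{a..b}. \<bar>f s\<bar> \<le> M"
  proof (induction rule: Bolzano)
    case (trans a b c)
    then obtain M M' where M: "\<forall>s\<in>{a..b}. \<bar>f s\<bar> \<le> M" "\<forall>s\<in>{b..c}. \<bar>f s\<bar> \<le> M'" by blast
    have "\<bar>f s\<bar> \<le> max M M'" if "s \<in> {a..c}" for s
      using M that by (cases "s \<le> b") (auto simp: le_max_iff_disj)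
    then show ?case by blast
  next
    case (local x)
    obtain l r where l: "(f \<longlongrightarrow> l) (at_left x)" and r: "(f \<longlongrightarrow> r) (at_right x)"
      using f unfolding piecewise_continuous_def by blast
    obtain c where c: "c < x" "\<And>y. c < y \<Longrightarrow> y < x \<Longrightarrow> dist (f y) l < 1"
      using tendstoD[OF l, of 1] by (auto simp: eventually_at_left_field)
    obtain d where d: "x < d" "\<And>y. x < y \<Longrightarrow> y < d \<Longrightarrow> dist (f y) r < 1"
      using tendstoD[OF r, of 1] by (auto simp: eventually_at_right_field)
    define M where "M = max (\<bar>f x\<bar>) (max (\<bar>l\<bar> + 1) (\<bar>r\<bar> + 1))"
    have M: "\<bar>f y\<bar> \<le> M" if "c < y" "y < d" for y
    proof (cases y x rule: linorder_cases)
      case less then have "\<bar>f y\<bar> \<le> \<bar>l\<bar> + 1" using c(2)[of y] that by (auto simp: dist_real_def)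
      then show ?thesis by (simp add: M_def)
    next
      case greater then have "\<bar>f y\<bar> \<le> \<bar>r\<bar> + 1" using d(2)[of y] that by (auto simp: dist_real_def)
      then show ?thesis by (simp add: M_def)
    qed (simp add: M_def)
    show ?case
    proof (rule exI[of _ "min (x - c) (d - x)"], intro conjI allI impI)
      fix a b assume "a \<le> x \<and> x \<le> b \<and> b - a < min (x - c) (d - x)"
      then show "\<exists>M. \<forall>s\<in>{a..b}. \<bar>f s\<bar> \<le> M" by (intro exI[of _ M] ballI M) auto
    qed (use c d in auto)
  qed
  then obtain M where M: "\<forall>s\<in>{a..b}. \<bar>f s\<bar> \<le> M" by blast
  then have "M \<ge> 0" using True by force
  then show thesis using that M by blast
qed (use that[of 0] in auto)

lemma piecewise_continuous_countable_discont:
  assumes "piecewise_continuous f"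
  shows "countable {s. \<not> isCont f s}"
proof -
  have "{s. \<not> isCont f s} \<subseteq> (\<Union>n::nat. {s \<in> {-real n..real n}. \<not> isCont f s})"
  proof
    fix s assume s: "s \<in> {s. \<not> isCont f s}"
    obtain n :: nat where "\<bar>s\<bar> \<le> real n" using real_arch_simple by blast
    then show "s \<in> (\<Union>n::nat. {s \<in> {-real n..real n}. \<not> isCont f s})" using s by (intro UN_I[of n]) auto
  qed
  moreover have "countable (\<Union>n::nat. {s \<in> {-real n..real n}. \<not> isCont f s})"
    using assms by (intro countable_UN) (auto simp: piecewise_continuous_def intro: countable_finite)
  ultimately show ?thesis by (rule countable_subset)
qed

lemma piecewise_continuous_integrable:
  assumes f: "piecewise_continuous f"
  shows "f integrable_on {a..b}"
proof -
  obtain M where M: "M \<ge> 0" "\<And>s. s \<in> {a..b} \<Longrightarrow> \<bar>f s\<bar> \<le> M" using piecewise_continuous_bounded[OF f] by blast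
  have "f \<in> borel_measurable borel"
    using piecewise_continuous_countable_discont[OF f]
    by (rule borel_measurable_continuous_countable_exceptions) (auto intro: continuous_at_imp_continuous_on)
  then have "f \<in> borel_measurable (lebesgue_on {a..b})" by (simp add: measurable_completion measurable_restrict_space1)
  then show ?thesis
    by (rule measurable_bounded_by_integrable_imp_integrable_real[where g = "\<lambda>_. M"]) (use M in auto)
qed

text \<open>Integrals over empty intervals vanish, so exactly one of the two terms is active.\<close>

definition primitive0 :: "(real \<Rightarrow> real) \<Rightarrow> real \<Rightarrow> real" where
  "primitive0 f y = integral {0..y} f - integral {y..0} f"

lemma primitive0_0 [simp]: "primitive0 f 0 = 0"
  by (simp add: primitive0_def)

lemma primitive0_diff:
  assumes f: "piecewise_continuous f" and ab: "a \<le> b"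
  shows "primitive0 f b - primitive0 f a = integral {a..b} f"
proof -
  note int = piecewise_continuous_integrable[OF f]
  have c: "integral {p..q} f + integral {q..r} f = integral {p..r} f" if "p \<le> q" "q \<le> r" for p q r
    using that int by (intro Henstock_Kurzweil_Integration.integral_combine) auto
  have z: "integral {p..q} f = 0" if "q \<le> p" for p q
    using that by (cases "p = q") auto
  consider "0 \<le> a" | "a \<le> 0" "0 \<le> b" | "b \<le> 0" by linarith
  then show ?thesis
    using c[of 0 a b] c[of a 0 b] c[of a b 0] z[of 0 a] z[of 0 b] z[of a 0] z[of b 0] ab
    by cases (auto simp: primitive0_def)
qed

lemma primitive0_Lipschitz:
  assumes f: "piecewise_continuous f" and M: "\<And>s. s \<in> {a..b} \<Longrightarrow> \<bar>f s\<bar> \<le> M"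
    and st: "s \<in> {a..b}" "t \<in> {a..b}"
  shows "\<bar>primitive0 f s - primitive0 f t\<bar> \<le> M * \<bar>s - t\<bar>"
proof -
  have *: "\<bar>primitive0 f t - primitive0 f s\<bar> \<le> M * (t - s)" if "s \<le> t" "s \<in> {a..b}" "t \<in> {a..b}" for s t
  proof -
    have "norm (integral {s..t} f) \<le> M * (t - s)"
      using has_integral_bound_real[OF _ finite.emptyI integrable_integral[OF piecewise_continuous_integrable[OF f, of s t]], of M]
        that M[of s] M by force
    then show ?thesis using primitive0_diff[OF f that(1)] by simp
  qed
  show ?thesis using *[of s t] *[of t s] st by (cases "s \<le> t") (auto simp: abs_minus_commute)
qed

lemma primitive0_has_derivative:
  assumes f: "piecewise_continuous f" and c: "isCont f y"
  shows "(primitive0 f has_real_derivative f y) (at y)"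
proof -
  \<comment> \<open>Integrating from \<open>y - 1\<close> in place of 0 makes \<open>y\<close> an
    interior point of the interval whatever its sign.\<close>
  have "((\<lambda>u. integral {y-1..u} f) has_vector_derivative f y) (at y within ({y-1..y+1} - {}))"
    by (rule integral_has_vector_derivative_continuous_at[OF piecewise_continuous_integrable[OF f]])
       (use c in \<open>auto intro: continuous_at_imp_continuous_at_within\<close>)
  then have "((\<lambda>u. primitive0 f (y - 1) + integral {y-1..u} f) has_vector_derivative f y) (at y within {y-1..y+1})"
    by (auto intro!: derivative_eq_intros)
  then have "(primitive0 f has_vector_derivative f y) (at y within {y-1..y+1})"
    by (rule has_vector_derivative_transform[rotated 2]) (use primitive0_diff[OF f, of "y-1"] in force)+
  moreover have "at y within {y-1..y+1} = at y" by (rule at_within_interior) auto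
  ultimately show ?thesis by (simp add: has_real_derivative_iff_has_vector_derivative)
qed

text \<open>The sign condition \<open>f s * s \<ge> 0\<close> leaves \<open>f 0\<close> free, and a
  single point does not affect the integral.\<close>

lemma integral_nonneg_except_0:
  fixes f :: "real \<Rightarrow> real"
  assumes "f integrable_on {a..b}" "\<And>s. s \<in> {a..b} \<Longrightarrow> s \<noteq> 0 \<Longrightarrow> f s \<ge> 0"
  shows "integral {a..b} f \<ge> 0"
proof -
  have "integral {a..b} f = integral {a..b} (\<lambda>s. if s = 0 then 0 else f s)"
    by (rule integral_spike[of "{0}"]) auto
  also have "\<dots> \<ge> 0"
  proof (rule integral_nonneg)
    show "(\<lambda>s. if s = 0 then 0 else f s) integrable_on {a..b}"
      by (rule integrable_spike[OF assms(1), of "{0}"]) auto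
  qed (use assms(2) in auto)
  finally show ?thesis .
qed

lemma primitive0_mono:
  assumes f: "piecewise_continuous f" and sgn: "\<And>s. f s * s \<ge> 0" and "0 \<le> a" "a \<le> b"
  shows "primitive0 f a \<le> primitive0 f b"
proof -
  have "integral {a..b} f \<ge> 0"
  proof (rule integral_nonneg_except_0[OF piecewise_continuous_integrable[OF f]])
    fix s assume "s \<in> {a..b}" "s \<noteq> 0" then show "f s \<ge> 0" using sgn[of s] assms(3) by (auto simp: zero_le_mult_iff)
  qed
  then show ?thesis using primitive0_diff[OF f \<open>a \<le> b\<close>] by simp
qed

lemma primitive0_antimono:
  assumes f: "piecewise_continuous f" and sgn: "\<And>s. f s * s \<ge> 0" and "b \<le> 0" "a \<le> b"
  shows "primitive0 f b \<le> primitive0 f a"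
proof -
  have "integral {a..b} (\<lambda>s. - f s) \<ge> 0"
  proof (rule integral_nonneg_except_0[OF integrable_neg[OF piecewise_continuous_integrable[OF f]]])
    fix s assume "s \<in> {a..b}" "s \<noteq> 0" then show "- f s \<ge> 0" using sgn[of s] assms(3) by (auto simp: zero_le_mult_iff)
  qed
  then show ?thesis using primitive0_diff[OF f \<open>a \<le> b\<close>] by simp
qed

lemma primitive0_nonneg:
  assumes f: "piecewise_continuous f" and sgn: "\<And>s. f s * s \<ge> 0"
  shows "primitive0 f a \<ge> 0"
  using primitive0_mono[OF f sgn, of 0 a] primitive0_antimono[OF f sgn, of 0 a] by (cases "a \<ge> 0") auto

text \<open>The primitive is nonincreasing before 0, nonincreasing backwards towards 0 from the
  right, and nonnegative. Adding its values at both ends gives a bound through |y| alone, as needed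
  to bound \<open>V\<close> by a function of the norm.\<close>

lemma primitive0_le:
  assumes f: "piecewise_continuous f" and sgn: "\<And>s. f s * s \<ge> 0" and "\<bar>y\<bar> \<le> r"
  shows "primitive0 f y \<le> primitive0 f r + primitive0 f (- r)"
  using primitive0_mono[OF f sgn, of y r] primitive0_antimono[OF f sgn, of 0 y] primitive0_antimono[OF f sgn, of y "-r"]
    primitive0_nonneg[OF f sgn, of r] primitive0_nonneg[OF f sgn, of "-r"] assms(3)
  by (cases "y \<ge> 0") (auto simp: abs_le_iff)

lemma primitive0_continuous:
  assumes f: "piecewise_continuous f"
  shows "continuous_on S (primitive0 f)"
proof -
  have "continuous (at y) (primitive0 f)" for y
  proof -
    obtain M where M: "M \<ge> 0" "\<And>s. s \<in> {y-1..y+1} \<Longrightarrow> \<bar>f s\<bar> \<le> M" using piecewise_continuous_bounded[OF f] by blast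
    have "M-lipschitz_on {y-1..y+1} (primitive0 f)"
      using primitive0_Lipschitz[OF f M(2)] M(1) by (auto intro!: lipschitz_onI simp: dist_real_def)
    then have "continuous_on {y-1..y+1} (primitive0 f)" by (rule lipschitz_on_continuous_on)
    then show ?thesis by (rule continuous_on_interior) auto
  qed
  then show ?thesis by (simp add: continuous_at_imp_continuous_on)
qed

section \<open>The Krasovskii regularization of a scalar function\<close>

lemma kras_subset:
  assumes "\<delta> > 0" "\<And>s. s \<in> {y-\<delta>..y+\<delta>} \<Longrightarrow> f s \<in> {lo..hi}"
  shows "kras f y \<subseteq> {lo..hi}"
proof -
  have "kras f y \<subseteq> closure (convex hull (f ` {y-\<delta>..y+\<delta>}))" using assms(1) by (auto simp: kras_def)
  also have "\<dots> \<subseteq> {lo..hi}" using assms(2) by (intro closure_minimal hull_minimal) auto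
  finally show ?thesis .
qed

lemma closed_kras: "closed (kras f y)"
  unfolding kras_def by (intro closed_INT) auto

lemma convex_kras: "convex (kras f y)"
  unfolding kras_def by (intro convex_INT convex_closure) auto

text \<open>Closed graph along values of \<open>f\<close>: for each \<delta> the arguments
  eventually lie in the window around \<open>l\<close>, and the closed hull over that window keeps
  the limit.\<close>

lemma kras_limit:
  assumes y: "y \<longlonglongrightarrow> l" and w: "(\<lambda>n. f (y n)) \<longlonglongrightarrow> w"
  shows "w \<in> kras f l"
  unfolding kras_def
proof
  fix \<delta> :: real assume "\<delta> \<in> {0<..}"
  then have "eventually (\<lambda>n. dist (y n) l < \<delta>) sequentially" using tendstoD[OF y] by simp
  then have "eventually (\<lambda>n. f (y n) \<in> closure (convex hull (f ` {l - \<delta>..l + \<delta>}))) sequentially"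
  proof eventually_elim
    case (elim n)
    then have "y n \<in> {l - \<delta>..l + \<delta>}" by (auto simp: dist_real_def)
    then have "f (y n) \<in> f ` {l - \<delta>..l + \<delta>}" by (rule imageI)
    then show ?case by (meson closure_subset hull_subset subsetD)
  qed
  then show "w \<in> closure (convex hull (f ` {l - \<delta>..l + \<delta>}))"
    by (intro Lim_in_closed_set[OF _ _ _ w]) auto
qed

lemma kras_self: "f y \<in> kras f y"
  by (rule kras_limit[of "\<lambda>_. y"]) auto

text \<open>A window on which \<open>f\<close> varies by less than \<open>e\<close> confines the set
  to within \<open>e\<close> of \<open>f y\<close>. Off the jumps the inclusion thus falls back to
  the ordinary feedback.\<close>

lemma kras_isCont:
  assumes c: "isCont f y" and w: "w \<in> kras f y"
  shows "w = f y"
proof -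
  have "\<bar>w - f y\<bar> \<le> e" if e: "e > 0" for e
  proof -
    obtain d where d: "d > 0" "\<And>x. \<bar>x - y\<bar> < d \<Longrightarrow> \<bar>f x - f y\<bar> < e"
      using c e unfolding continuous_at_eps_delta dist_real_def by blast
    have "kras f y \<subseteq> {f y - e..f y + e}"
    proof (rule kras_subset)
      show "d / 2 > 0" using d by simp
      fix s assume "s \<in> {y - d/2..y + d/2}"
      then have "\<bar>s - y\<bar> < d" using d(1) by (auto simp: abs_less_iff)
      then show "f s \<in> {f y - e..f y + e}" using d(2)[of s] by (auto simp: abs_less_iff)
    qed
    then show ?thesis using w by (auto simp: abs_le_iff)
  qed
  then have "\<bar>w - f y\<bar> \<le> 0" by (rule field_le_epsilon) simp
  then show ?thesis by simp
qed

text \<open>For nonzero \<open>y\<close> the window of half-width |y|/2 stays on one side of 0,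
  where the values have one sign; at 0 the product vanishes.\<close>

lemma kras_sign:
  assumes sgn: "\<And>s. f s * s \<ge> 0" and w: "w \<in> kras f y"
  shows "w * y \<ge> 0"
proof -
  consider "y = 0" | "y > 0" | "y < 0" by linarith
  then show ?thesis
  proof cases
    case 2
    have "kras f y \<subseteq> {0..}"
    proof -
      have "f ` {y - y/2..y + y/2} \<subseteq> {0..}"
      proof (rule image_subsetI)
        fix s assume "s \<in> {y - y/2..y + y/2}"
        then have "s > 0" using 2 by simp
        then show "f s \<in> {0..}" using sgn[of s] by (simp add: zero_le_mult_iff)
      qed
      then have "closure (convex hull (f ` {y - y/2..y + y/2})) \<subseteq> {0..}" by (intro closure_minimal hull_minimal) auto
      moreover have "kras f y \<subseteq> closure (convex hull (f ` {y - y/2..y + y/2}))" unfolding kras_def using 2 by (intro INT_lower) simp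
      ultimately show ?thesis by blast
    qed
    then show ?thesis using w 2 by auto
  next
    case 3
    have "kras f y \<subseteq> {..0}"
    proof -
      have "f ` {y - (-y)/2..y + (-y)/2} \<subseteq> {..0}"
      proof (rule image_subsetI)
        fix s assume "s \<in> {y - (-y)/2..y + (-y)/2}"
        then have "s < 0" using 3 by simp
        then show "f s \<in> {..0}" using sgn[of s] by (simp add: zero_le_mult_iff)
      qed
      then have "closure (convex hull (f ` {y - (-y)/2..y + (-y)/2})) \<subseteq> {..0}" by (intro closure_minimal hull_minimal) auto
      moreover have "kras f y \<subseteq> closure (convex hull (f ` {y - (-y)/2..y + (-y)/2}))" unfolding kras_def using 3 by (intro INT_lower) simp
      ultimately show ?thesis by blast
    qed
    then show ?thesis using w 3 by (auto simp: mult_nonpos_nonpos)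
  qed simp
qed

text \<open>For \<open>z > 0\<close> the quadratic condition says that \<open>f s\<close> lies
  between 0 and \<open>z * s\<close>, an interval condition that closed convex hulls preserve. A
  window of half-width \<open>e / z\<close> moves the ends by at most \<open>e\<close>, and
  \<open>e\<close> is arbitrary.\<close>

lemma kras_sector:
  assumes z: "z > 0" and sec: "\<And>s. f s * (f s - z * s) \<le> 0" and w: "w \<in> kras f y"
  shows "w * (w - z * y) \<le> 0"
proof -
  have bd: "f s \<in> {min 0 (z * s)..max 0 (z * s)}" for s
    using sec[of s] by (auto simp: mult_le_0_iff min_le_iff_disj le_max_iff_disj)
  have "w \<in> {min 0 (z * y) - e..max 0 (z * y) + e}" if e: "e > 0" for e
  proof -
    have "kras f y \<subseteq> {min 0 (z * y) - e..max 0 (z * y) + e}"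
    proof (rule kras_subset)
      show "e / z > 0" using e z by simp
      fix s assume "s \<in> {y - e/z..y + e/z}"
      then have "z * (y - e/z) \<le> z * s" "z * s \<le> z * (y + e/z)" using z by (auto intro!: mult_left_mono)
      moreover have "z * (e / z) = e" using z by simp
      ultimately have "z * y - e \<le> z * s" "z * s \<le> z * y + e" by (auto simp: right_diff_distrib distrib_left)
      then show "f s \<in> {min 0 (z * y) - e..max 0 (z * y) + e}" using bd[of s] e by auto
    qed
    then show ?thesis using w by blast
  qed
  then have "min 0 (z * y) \<le> w + e" "w \<le> max 0 (z * y) + e" if "e > 0" for e using that by force+
  then have "min 0 (z * y) \<le> w" "w \<le> max 0 (z * y)" by (auto intro: field_le_epsilon)
  then show ?thesis using z by (auto simp: mult_le_0_iff min_le_iff_disj le_max_iff_disj zero_le_mult_iff)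
qed

section \<open>The Lyapunov function\<close>

text \<open>The gap to the right of each point holds a rational below all later points, and these
  rationals are distinct.\<close>

lemma countable_separated:
  fixes T :: "real set"
  assumes "\<And>t. t \<in> T \<Longrightarrow> \<exists>e>0. \<forall>s\<in>T. s \<noteq> t \<longrightarrow> \<bar>s - t\<bar> \<ge> e"
  shows "countable T"
proof -
  have "\<forall>t\<in>T. \<exists>q\<in>\<rat>. t < q \<and> (\<forall>s\<in>T. t < s \<longrightarrow> q < s)"
  proof
    fix t assume t: "t \<in> T"
    then obtain e where e: "e > 0" "\<And>s. s \<in> T \<Longrightarrow> s \<noteq> t \<Longrightarrow> \<bar>s - t\<bar> \<ge> e" using assms by blast
    obtain q where "q \<in> \<rat>" "t < q" "q < t + e" using Rats_dense_in_real[of t "t + e"] e(1) by auto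
    moreover have "q < s" if "s \<in> T" "t < s" for s using e(2)[of s] that \<open>q < t + e\<close> by auto
    ultimately show "\<exists>q\<in>\<rat>. t < q \<and> (\<forall>s\<in>T. t < s \<longrightarrow> q < s)" by blast
  qed
  then obtain q where q: "\<And>t. t \<in> T \<Longrightarrow> q t \<in> \<rat>" "\<And>t. t \<in> T \<Longrightarrow> t < q t"
    "\<And>t s. t \<in> T \<Longrightarrow> s \<in> T \<Longrightarrow> t < s \<Longrightarrow> q t < s"
    using bchoice[of T "\<lambda>t q. q \<in> \<rat> \<and> t < q \<and> (\<forall>s\<in>T. t < s \<longrightarrow> q < s)"] by blast
  have "inj_on q T"
  proof (rule inj_onI)
    fix s t assume st: "s \<in> T" "t \<in> T" "q s = q t"
    show "s = t"
      using q(2)[OF st(1)] q(2)[OF st(2)] q(3)[OF st(1,2)] q(3)[OF st(2,1)] st(3) by (cases s t rule: linorder_cases) auto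
  qed
  moreover have "countable (q ` T)" by (rule countable_subset[OF _ countable_rat]) (use q(1) in auto)
  ultimately show ?thesis using countable_image_inj_on by blast
qed

text \<open>Such times are isolated in the level set: near them the difference quotient is nonzero,
  so the value is not taken again. They are the times at which the chain rule for a primitive with a
  jump can fail.\<close>

lemma countable_level_set_nonzero_derivative:
  fixes y :: "real \<Rightarrow> real"
  shows "countable {t \<in> S. y t = s \<and> (\<exists>d. d \<noteq> 0 \<and> (y has_real_derivative d) (at t within S))}" (is "countable ?T")
proof (rule countable_separated)
  fix t assume "t \<in> ?T"
  then obtain d where t: "t \<in> S" "y t = s" and d: "d \<noteq> 0" "((\<lambda>u. (y u - y t) / (u - t)) \<longlongrightarrow> d) (at t within S)"
    by (auto simp: has_field_derivative_iff)
  have "eventually (\<lambda>u. (y u - y t) / (u - t) \<noteq> 0) (at t within S)"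
    using tendsto_imp_eventually_ne[OF d(2,1)] .
  then obtain e where e: "e > 0" "\<And>u. u \<in> S \<Longrightarrow> u \<noteq> t \<Longrightarrow> dist u t < e \<Longrightarrow> (y u - y t) / (u - t) \<noteq> 0"
    unfolding eventually_at by blast
  show "\<exists>e>0. \<forall>u\<in>?T. u \<noteq> t \<longrightarrow> \<bar>u - t\<bar> \<ge> e"
  proof (intro exI[of _ e] conjI ballI impI e(1))
    fix u assume u: "u \<in> ?T" "u \<noteq> t"
    have "u \<in> S" "y u = y t" using u(1) t by auto
    then show "\<bar>u - t\<bar> \<ge> e" using e(2)[of u] u(2) by (fastforce simp: dist_real_def)
  qed
qed

text \<open>At a jump the speed is zero. There a local bound \<open>M\<close> of |f| dominates the
  difference quotient of the composition by \<open>M\<close> times that of \<open>y\<close>, which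
  tends to 0.\<close>

lemma primitive0_comp_derivative:
  fixes y :: "real \<Rightarrow> real"
  assumes f: "piecewise_continuous f" and y: "(y has_real_derivative d) (at t within S)"
    and w: "w \<in> kras f (y t)" and or: "isCont f (y t) \<or> d = 0"
  shows "((\<lambda>s. primitive0 f (y s)) has_real_derivative w * d) (at t within S)"
proof (cases "isCont f (y t)")
  case True
  then show ?thesis
    using DERIV_chain'[OF y primitive0_has_derivative[OF f True]] kras_isCont[OF True w] by (simp add: mult.commute)
next
  case False
  then have d: "d = 0" using or by blast
  obtain M where M: "M \<ge> 0" "\<And>s. s \<in> {y t - 1..y t + 1} \<Longrightarrow> \<bar>f s\<bar> \<le> M" using piecewise_continuous_bounded[OF f] by blast
  have "continuous (at t within S) y" using y by (rule DERIV_continuous)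
  then have "(y \<longlongrightarrow> y t) (at t within S)" by (simp add: continuous_within)
  then have "eventually (\<lambda>s. dist (y s) (y t) < 1) (at t within S)" by (rule tendstoD) simp
  then have ev: "eventually (\<lambda>s. norm ((primitive0 f (y s) - primitive0 f (y t)) / (s - t)) \<le> M * \<bar>(y s - y t) / (s - t)\<bar>) (at t within S)"
  proof eventually_elim
    case (elim s)
    have "\<bar>primitive0 f (y s) - primitive0 f (y t)\<bar> \<le> M * \<bar>y s - y t\<bar>"
      using elim by (intro primitive0_Lipschitz[OF f M(2)]) (auto simp: dist_real_def abs_less_iff)
    then have "\<bar>primitive0 f (y s) - primitive0 f (y t)\<bar> / \<bar>s - t\<bar> \<le> M * \<bar>y s - y t\<bar> / \<bar>s - t\<bar>"
      by (intro divide_right_mono) auto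
    then show ?case by (simp add: abs_divide)
  qed
  have "((\<lambda>s. (y s - y t) / (s - t)) \<longlongrightarrow> 0) (at t within S)" using y unfolding d has_field_derivative_iff .
  then have "((\<lambda>s. M * \<bar>(y s - y t) / (s - t)\<bar>) \<longlongrightarrow> 0) (at t within S)"
    using tendsto_mult_right_zero tendsto_rabs_zero by blast
  then have "((\<lambda>s. (primitive0 f (y s) - primitive0 f (y t)) / (s - t)) \<longlongrightarrow> 0) (at t within S)"
    by (rule Lim_null_comparison[OF ev])
  then show ?thesis by (simp add: d has_field_derivative_iff)
qed

lemma inner_diag_mat: "w \<bullet> (diag_mat d *v y) = (\<Sum>i\<in>UNIV. d i * (w $ i * y $ i))"
proof -
  have "(diag_mat d *v y) $ i = d i * y $ i" for i
    by (simp add: diag_mat_def matrix_vector_mult_def if_distrib[where f = "\<lambda>x. x * _"] cong: if_cong)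
  then show ?thesis by (simp add: inner_vec_def algebra_simps)
qed

lemma inner_transpose_mult:
  fixes M :: "real^'a^'b"
  shows "x \<bullet> (transpose M *v y) = (M *v x) \<bullet> y"
  by (metis dot_lmul_matrix inner_commute transpose_matrix_vector)

lemma di_solution_subset:
  assumes "di_solution G I x" "a \<in> I" "b \<in> I"
  shows "{a..b} \<subseteq> I"
proof
  fix t assume "t \<in> {a..b}"
  moreover have "is_interval I" using assms(1) by (simp add: di_solution_def)
  ultimately show "t \<in> I" using mem_is_interval_1_I[of I a b t] assms(2,3) by simp
qed

text \<open>\<open>LMI\<close> is the block matrix inequality written as a quadratic form in
  \<open>(\<xi>, \<omega>)\<close>. As \<open>P\<close> is symmetric, the off-diagonal blocks are
  transposes of each other, hence one mixed term with factor 2.\<close>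

locale lure_system =
  fixes A :: "real^'n^'n" and B :: "real^'p^'n" and C :: "real^'n^'p"
    and \<psi> :: "'p \<Rightarrow> real \<Rightarrow> real" and \<zeta> :: "'p \<Rightarrow> ereal"
    and \<gamma> :: "'p \<Rightarrow> real" and P :: "real^'n^'n" and \<eta> :: real
  assumes pwc: "\<And>i. piecewise_continuous (\<psi> i)"
    and zeta_pos: "\<And>i. \<zeta> i > 0"
    and sector_fin: "\<And>i s. \<zeta> i \<noteq> \<infinity> \<Longrightarrow> \<psi> i s * (\<psi> i s - real_of_ereal (\<zeta> i) * s) \<le> 0"
    and sector_inf: "\<And>i s. \<zeta> i = \<infinity> \<Longrightarrow> \<psi> i s * s \<ge> 0"
    and gamma_pos: "\<And>i. \<gamma> i > 0"
    and P_sym: "transpose P = P"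
    and P_pos: "\<And>\<xi>. \<xi> \<noteq> 0 \<Longrightarrow> \<xi> \<bullet> (P *v \<xi>) > 0"
    and eta_pos: "\<eta> > 0"
    and LMI: "\<And>\<xi> \<omega>.
       \<xi> \<bullet> ((P ** A + transpose A ** P + \<eta> *\<^sub>R mat 1) *v \<xi>)
       + 2 * (\<xi> \<bullet> ((P ** B - transpose (C + diag_mat \<gamma> ** C ** A)) *v \<omega>))
       + \<omega> \<bullet> ((- 2 *\<^sub>R diag_mat (\<lambda>i. inv_ereal0 (\<zeta> i))
                 - diag_mat \<gamma> ** C ** B - transpose (diag_mat \<gamma> ** C ** B)) *v \<omega>) \<le> 0"
begin

section \<open>Sector condition and matrix inequality\<close>

lemma zeta_real_pos:
  assumes "\<zeta> i \<noteq> \<infinity>" shows "real_of_ereal (\<zeta> i) > 0"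
  using zeta_pos[of i] assms by (cases "\<zeta> i") auto

lemma psi_sign: "\<psi> i s * s \<ge> 0"
proof (cases "\<zeta> i = \<infinity>")
  case False
  let ?z = "real_of_ereal (\<zeta> i)"
  have "?z * (\<psi> i s * s) \<ge> \<psi> i s * \<psi> i s" using sector_fin[OF False, of s] by (simp add: algebra_simps)
  moreover have "\<psi> i s * \<psi> i s \<ge> 0" by simp
  ultimately have "?z * (\<psi> i s * s) \<ge> 0" by linarith
  then show ?thesis using mult_pos_neg[OF zeta_real_pos[OF False], of "\<psi> i s * s"] by linarith
qed (use sector_inf in auto)

text \<open>Dividing the sector inequality by \<zeta> gives a form that survives an infinite
  \<zeta>: the coefficient becomes 0 and the sign condition remains. In this form it meets the block
  with \<open>inv_ereal0\<close> in \<open>LMI\<close>.\<close>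

lemma kras_psi_sector:
  assumes w: "w \<in> kras (\<psi> i) y"
  shows "inv_ereal0 (\<zeta> i) * (w * w) \<le> w * y"
proof (cases "\<zeta> i = \<infinity>")
  case True
  then show ?thesis using kras_sign[OF psi_sign w] by (simp add: inv_ereal0_def)
next
  case False
  let ?z = "real_of_ereal (\<zeta> i)"
  have "w * (w - ?z * y) \<le> 0" by (rule kras_sector[OF zeta_real_pos[OF False] sector_fin[OF False] w])
  then have "w * w \<le> ?z * (w * y)" by (simp add: algebra_simps)
  then show ?thesis using zeta_real_pos[OF False] False by (simp add: inv_ereal0_def field_simps)
qed

lemma LMI_dissipation:
  assumes w: "w \<in> kras_vec \<psi> (C *v x)"
  defines "v \<equiv> A *v x - B *v w"
  shows "2 * (x \<bullet> (P *v v)) + 2 * (\<Sum>i\<in>UNIV. \<gamma> i * (w $ i * (C *v v) $ i)) \<le> - \<eta> * (norm x)\<^sup>2"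
proof -
  define D where "D = diag_mat \<gamma>"
  define Z where "Z = diag_mat (\<lambda>i. inv_ereal0 (\<zeta> i))"
  have Pt: "(P *v a) \<bullet> b = a \<bullet> (P *v b)" for a b
    using inner_transpose_mult[of a P b] P_sym by simp
  have tA: "x \<bullet> (transpose A *v (P *v x)) = x \<bullet> (P *v (A *v x))"
    unfolding inner_transpose_mult using Pt[of x "A *v x"] inner_commute[of "P *v x" "A *v x"] by simp
  have 1: "x \<bullet> ((P ** A + transpose A ** P + \<eta> *\<^sub>R mat 1) *v x) = 2 * (x \<bullet> (P *v (A *v x))) + \<eta> * (x \<bullet> x)"
    by (simp add: matrix_vector_mult_add_rdistrib inner_add_right scaleR_matrix_vector_assoc[symmetric] tA
        del: transpose_matrix_vector flip: matrix_vector_mul_assoc)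
  have neg: "M *v (- w) = - (M *v w)" for M :: "real^'p^'m"
    using matrix_vector_mult_scaleR[of M "-1" w] by simp
  have tC: "x \<bullet> (transpose (C + D ** C ** A) *v w) = (C *v x) \<bullet> w + w \<bullet> (D *v (C *v (A *v x)))"
    unfolding inner_transpose_mult
    by (simp add: matrix_vector_mult_add_rdistrib inner_add_left inner_commute[of w] flip: matrix_vector_mul_assoc)
  have 2: "x \<bullet> ((P ** B - transpose (C + D ** C ** A)) *v (- w))
      = - (x \<bullet> (P *v (B *v w))) + (C *v x) \<bullet> w + w \<bullet> (D *v (C *v (A *v x)))"
    unfolding neg matrix_vector_mult_diff_rdistrib inner_minus_right inner_diff_right tC
    by (simp flip: matrix_vector_mul_assoc)
  have tD: "w \<bullet> (transpose (D ** C ** B) *v w) = w \<bullet> (D *v (C *v (B *v w)))"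
    unfolding inner_transpose_mult by (simp add: inner_commute[of w] flip: matrix_vector_mul_assoc)
  have 3: "(- w) \<bullet> ((- 2 *\<^sub>R Z - D ** C ** B - transpose (D ** C ** B)) *v (- w))
      = - 2 * (w \<bullet> (Z *v w)) - 2 * (w \<bullet> (D *v (C *v (B *v w))))"
    unfolding neg matrix_vector_mult_diff_rdistrib inner_minus_right inner_minus_left inner_diff_right tD
      scaleR_matrix_vector_assoc[symmetric]
    by (simp flip: matrix_vector_mul_assoc)
  have "(2 * (x \<bullet> (P *v (A *v x))) + \<eta> * (x \<bullet> x)) + 2 * (- (x \<bullet> (P *v (B *v w))) + (C *v x) \<bullet> w + w \<bullet> (D *v (C *v (A *v x))))
      + (- 2 * (w \<bullet> (Z *v w)) - 2 * (w \<bullet> (D *v (C *v (B *v w))))) \<le> 0"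
    using LMI[of x "- w"] unfolding D_def[symmetric] Z_def[symmetric] 1 2 3 .
  moreover have "w \<bullet> (Z *v w) \<le> (C *v x) \<bullet> w"
    unfolding Z_def inner_diag_mat unfolding inner_vec_def
    using kras_psi_sector w by (intro sum_mono) (auto simp: kras_vec_def mult.commute)
  moreover have "x \<bullet> (P *v v) = x \<bullet> (P *v (A *v x)) - x \<bullet> (P *v (B *v w))"
    unfolding v_def by (simp add: matrix_vector_mult_diff_distrib inner_diff_right)
  moreover have "(\<Sum>i\<in>UNIV. \<gamma> i * (w $ i * (C *v v) $ i)) = w \<bullet> (D *v (C *v (A *v x))) - w \<bullet> (D *v (C *v (B *v w)))"
    unfolding inner_diag_mat[symmetric] D_def[symmetric] v_def
    by (simp add: matrix_vector_mult_diff_distrib inner_diff_right)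
  ultimately show ?thesis by (simp add: power2_norm_eq_inner)
qed

section \<open>Bounds and regularity of the Lyapunov function\<close>

text \<open>A Lur'e-Postnikov function: a quadratic form plus weighted integrals of the
  nonlinearities. The factor 2 matches the mixed terms of \<open>LMI\<close>. When \<psi> jumps it
  is locally Lipschitz, but in general not differentiable everywhere.\<close>

definition V :: "real^'n \<Rightarrow> real" where
  "V x = x \<bullet> (P *v x) + 2 * (\<Sum>i\<in>UNIV. \<gamma> i * primitive0 (\<psi> i) ((C *v x) $ i))"

text \<open>Homogeneity reduces the bound to the minimum over the unit sphere, which is attained and
  positive.\<close>

lemma P_lower:
  obtains lam where "lam > 0" "\<And>x. lam * (norm x)\<^sup>2 \<le> x \<bullet> (P *v x)"
proof -
  have "continuous_on (sphere 0 1) (\<lambda>x. x \<bullet> (P *v x))" by (intro continuous_intros)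
  moreover have "sphere (0 :: real^'n) 1 \<noteq> {}" by simp
  ultimately obtain u where u: "u \<in> sphere 0 1" "\<And>x. x \<in> sphere 0 1 \<Longrightarrow> u \<bullet> (P *v u) \<le> x \<bullet> (P *v x)"
    using continuous_attains_inf[of "sphere 0 1" "\<lambda>x. x \<bullet> (P *v x)"] by auto
  show thesis
  proof (rule that)
    show "u \<bullet> (P *v u) > 0" using u(1) by (intro P_pos) auto
    fix x :: "real^'n"
    show "u \<bullet> (P *v u) * (norm x)\<^sup>2 \<le> x \<bullet> (P *v x)"
    proof (cases "x = 0")
      case False
      have "u \<bullet> (P *v u) \<le> sgn x \<bullet> (P *v sgn x)" using False by (intro u(2)) (simp add: norm_sgn)
      also have "\<dots> = x \<bullet> (P *v x) / (norm x)\<^sup>2"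
        by (simp add: sgn_div_norm matrix_vector_mult_scaleR power2_eq_square divide_inverse)
      finally show ?thesis using False by (simp add: field_simps)
    qed simp
  qed
qed

lemma matrix_vector_mult_bound:
  fixes M :: "real^'a^'b"
  obtains K where "K > 0" "\<And>x. norm (M *v x) \<le> K * norm x"
proof -
  obtain K where "K > 0" "\<And>x. norm (M *v x) \<le> norm x * K"
    using bounded_linear.pos_bounded[OF matrix_vector_mul_bounded_linear[of M]] by blast
  then show thesis using that[of K] by (simp add: mult.commute)
qed

lemma psi_bound:
  obtains M where "M \<ge> 0" "\<And>i s. \<bar>s\<bar> \<le> r \<Longrightarrow> \<bar>\<psi> i s\<bar> \<le> M"
proof -
  have "\<exists>M\<ge>0. \<forall>s\<in>{-r..r}. \<bar>\<psi> i s\<bar> \<le> M" for i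
  proof -
    obtain M where "M \<ge> 0" "\<And>s. s \<in> {-r..r} \<Longrightarrow> \<bar>\<psi> i s\<bar> \<le> M"
      using piecewise_continuous_bounded[OF pwc] by blast
    then show ?thesis by blast
  qed
  then obtain M where M: "\<And>i. M i \<ge> 0" "\<And>i s. s \<in> {-r..r} \<Longrightarrow> \<bar>\<psi> i s\<bar> \<le> M i"
    using choice[of "\<lambda>i M. M\<ge>0 \<and> (\<forall>s\<in>{-r..r}. \<bar>\<psi> i s\<bar> \<le> M)"] by blast
  have Mi: "M i \<le> (\<Sum>i\<in>UNIV. M i)" for i by (rule member_le_sum) (use M(1) in auto)
  have "\<bar>\<psi> i s\<bar> \<le> (\<Sum>i\<in>UNIV. M i)" if "\<bar>s\<bar> \<le> r" for i s
    using M(2)[of s i] Mi[of i] that by (auto simp: abs_le_iff)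
  moreover have "(\<Sum>i\<in>UNIV. M i) \<ge> 0" using M(1) by (intro sum_nonneg) auto
  ultimately show thesis using that by blast
qed

lemma V_lower:
  obtains lam where "lam > 0" "\<And>x. lam * (norm x)\<^sup>2 \<le> V x"
proof -
  obtain lam where l: "lam > 0" "\<And>x. lam * (norm x)\<^sup>2 \<le> x \<bullet> (P *v x)" using P_lower by blast
  have "lam * (norm x)\<^sup>2 \<le> V x" for x
  proof -
    have "(\<Sum>i\<in>UNIV. \<gamma> i * primitive0 (\<psi> i) ((C *v x) $ i)) \<ge> 0"
      using primitive0_nonneg[OF pwc psi_sign] gamma_pos by (intro sum_nonneg mult_nonneg_nonneg) (auto intro: less_imp_le)
    then show ?thesis using l(2)[of x] by (simp add: V_def)
  qed
  with l(1) show thesis using that by blast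
qed

text \<open>Each component of \<open>C *v x\<close> is at most \<open>c * norm x\<close> in size, so
  the primitives taken at both \<open>c * r\<close> and \<open>- (c * r)\<close> bound the integral
  terms through the norm. The quadratic term supplies strict growth, as the primitives are only
  weakly monotone.\<close>

lemma V_upper:
  obtains \<alpha> where "continuous_on UNIV \<alpha>" "strict_mono_on {0..} \<alpha>" "\<alpha> 0 = (0::real)" "\<And>x. V x \<le> \<alpha> (norm x)"
proof -
  obtain K where K: "K > 0" "\<And>x. norm (P *v x) \<le> K * norm x" using matrix_vector_mult_bound by blast
  obtain c where c: "c > 0" "\<And>x. norm (C *v x) \<le> c * norm x" using matrix_vector_mult_bound by blast
  define \<alpha> where "\<alpha> r = K * r\<^sup>2 + 2 * (\<Sum>i\<in>UNIV. \<gamma> i * (primitive0 (\<psi> i) (c * r) + primitive0 (\<psi> i) (- (c * r))))" for r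
  show thesis
  proof (rule that)
    show "continuous_on UNIV \<alpha>" unfolding \<alpha>_def
      by (intro continuous_intros continuous_on_compose2[OF primitive0_continuous[OF pwc, of UNIV]]) auto
    show "\<alpha> 0 = 0" by (simp add: \<alpha>_def)
    have key: "\<gamma> i * (primitive0 (\<psi> i) a + primitive0 (\<psi> i) (- a)) \<le> \<gamma> i * (primitive0 (\<psi> i) b + primitive0 (\<psi> i) (- b))"
      if "0 \<le> a" "a \<le> b" for i a b
      using that gamma_pos[of i]
      by (intro mult_left_mono add_mono primitive0_mono[OF pwc psi_sign] primitive0_antimono[OF pwc psi_sign]) auto
    show "strict_mono_on {0..} \<alpha>"
    proof (rule strict_mono_onI)
      fix r s :: real assume rs: "r \<in> {0..}" "s \<in> {0..}" "r < s"
      then have crs: "c * r \<le> c * s" "0 \<le> c * r" using c(1) by auto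
      have "K * r\<^sup>2 < K * s\<^sup>2" using K(1) rs by (intro mult_strict_left_mono power_strict_mono) auto
      moreover have "(\<Sum>i\<in>UNIV. \<gamma> i * (primitive0 (\<psi> i) (c * r) + primitive0 (\<psi> i) (- (c * r))))
        \<le> (\<Sum>i\<in>UNIV. \<gamma> i * (primitive0 (\<psi> i) (c * s) + primitive0 (\<psi> i) (- (c * s))))"
        using key[OF crs(2,1)] by (rule sum_mono)
      ultimately show "\<alpha> r < \<alpha> s" by (simp add: \<alpha>_def)
    qed
    fix x
    have "x \<bullet> (P *v x) \<le> norm x * norm (P *v x)" by (rule norm_cauchy_schwarz)
    also have "\<dots> \<le> norm x * (K * norm x)" by (intro mult_left_mono K) auto
    finally have "x \<bullet> (P *v x) \<le> K * (norm x)\<^sup>2" by (simp add: power2_eq_square algebra_simps)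
    moreover have "(\<Sum>i\<in>UNIV. \<gamma> i * primitive0 (\<psi> i) ((C *v x) $ i))
        \<le> (\<Sum>i\<in>UNIV. \<gamma> i * (primitive0 (\<psi> i) (c * norm x) + primitive0 (\<psi> i) (- (c * norm x))))"
    proof (intro sum_mono mult_left_mono primitive0_le[OF pwc psi_sign])
      fix i show "\<bar>(C *v x) $ i\<bar> \<le> c * norm x" using component_le_norm_cart[of "C *v x" i] c(2)[of x] by linarith
    qed (use gamma_pos in \<open>auto intro: less_imp_le\<close>)
    ultimately show "V x \<le> \<alpha> (norm x)" by (simp add: V_def \<alpha>_def)
  qed
qed

text \<open>This makes \<open>V\<close> absolutely continuous along a solution over a compact time
  interval, where the state is bounded. In \<open>L\<close> the part \<open>2 * K * R\<close> comes
  from the quadratic form, and the sum from the bound \<open>M\<close> of \<psi> on the outputs that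
  occur.\<close>

lemma V_Lipschitz:
  obtains L where "\<And>x y. norm x \<le> R \<Longrightarrow> norm y \<le> R \<Longrightarrow> \<bar>V x - V y\<bar> \<le> L * norm (x - y)"
proof -
  obtain K where K: "K > 0" "\<And>x. norm (P *v x) \<le> K * norm x" using matrix_vector_mult_bound by blast
  obtain c where c: "c > 0" "\<And>x. norm (C *v x) \<le> c * norm x" using matrix_vector_mult_bound by blast
  obtain M where M: "M \<ge> 0" "\<And>i s. \<bar>s\<bar> \<le> c * R \<Longrightarrow> \<bar>\<psi> i s\<bar> \<le> M" using psi_bound by blast
  have Cb: "\<bar>(C *v x) $ i\<bar> \<le> c * norm x" for x i
    using component_le_norm_cart[of "C *v x" i] c(2)[of x] by linarith
  define L where "L = 2 * K * R + 2 * (\<Sum>i\<in>UNIV. \<gamma> i * (M * c))"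
  have "\<bar>V x - V y\<bar> \<le> L * norm (x - y)" if xy: "norm x \<le> R" "norm y \<le> R" for x y
  proof -
    have cb: "\<bar>a \<bullet> (P *v b)\<bar> \<le> K * (norm a * norm b)" for a b
    proof -
      have "\<bar>a \<bullet> (P *v b)\<bar> \<le> norm a * norm (P *v b)" by (rule Cauchy_Schwarz_ineq2)
      also have "\<dots> \<le> norm a * (K * norm b)" by (intro mult_left_mono K) auto
      finally show ?thesis by (simp add: algebra_simps)
    qed
    have "x \<bullet> (P *v x) - y \<bullet> (P *v y) = (x - y) \<bullet> (P *v x) + y \<bullet> (P *v (x - y))"
      by (simp add: inner_diff_left inner_diff_right matrix_vector_mult_diff_distrib)
    then have "\<bar>x \<bullet> (P *v x) - y \<bullet> (P *v y)\<bar> \<le> K * (norm (x - y) * norm x) + K * (norm y * norm (x - y))"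
      using cb[of "x - y" x] cb[of y "x - y"] by linarith
    also have "\<dots> \<le> K * (norm (x - y) * R) + K * (R * norm (x - y))"
      using K(1) xy by (intro add_mono mult_left_mono mult_right_mono) auto
    finally have 1: "\<bar>x \<bullet> (P *v x) - y \<bullet> (P *v y)\<bar> \<le> 2 * K * R * norm (x - y)" by (simp add: algebra_simps)
    have 2: "\<bar>primitive0 (\<psi> i) ((C *v x) $ i) - primitive0 (\<psi> i) ((C *v y) $ i)\<bar> \<le> M * c * norm (x - y)" for i
    proof -
      have r: "(C *v z) $ i \<in> {- (c * R)..c * R}" if "norm z \<le> R" for z
      proof -
        have "c * norm z \<le> c * R" using that c(1) by (intro mult_left_mono) auto
        then show ?thesis using Cb[of z i] by (auto simp: abs_le_iff)
      qed
      have "\<bar>primitive0 (\<psi> i) ((C *v x) $ i) - primitive0 (\<psi> i) ((C *v y) $ i)\<bar> \<le> M * \<bar>(C *v x) $ i - (C *v y) $ i\<bar>"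
        using M(2) by (intro primitive0_Lipschitz[OF pwc _ r[OF xy(1)] r[OF xy(2)]]) (auto simp: abs_le_iff)
      also have "\<dots> \<le> M * (c * norm (x - y))"
        using Cb[of "x - y" i] M(1) by (intro mult_left_mono) (auto simp: matrix_vector_mult_diff_distrib)
      finally show ?thesis by (simp add: algebra_simps)
    qed
    have "\<bar>(\<Sum>i\<in>UNIV. \<gamma> i * primitive0 (\<psi> i) ((C *v x) $ i)) - (\<Sum>i\<in>UNIV. \<gamma> i * primitive0 (\<psi> i) ((C *v y) $ i))\<bar>
        \<le> (\<Sum>i\<in>UNIV. \<bar>\<gamma> i * primitive0 (\<psi> i) ((C *v x) $ i) - \<gamma> i * primitive0 (\<psi> i) ((C *v y) $ i)\<bar>)"
      unfolding sum_subtractf[symmetric] by (rule sum_abs)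
    also have "\<dots> \<le> (\<Sum>i\<in>UNIV. \<gamma> i * (M * c * norm (x - y)))"
    proof (rule sum_mono)
      fix i
      show "\<bar>\<gamma> i * primitive0 (\<psi> i) ((C *v x) $ i) - \<gamma> i * primitive0 (\<psi> i) ((C *v y) $ i)\<bar> \<le> \<gamma> i * (M * c * norm (x - y))"
        unfolding right_diff_distrib[symmetric] abs_mult using gamma_pos[of i] 2[of i] by (simp add: mult_left_mono)
    qed
    also have "\<dots> = (\<Sum>i\<in>UNIV. \<gamma> i * (M * c)) * norm (x - y)" by (simp add: sum_distrib_right mult.assoc)
    finally have 3: "\<bar>(\<Sum>i\<in>UNIV. \<gamma> i * primitive0 (\<psi> i) ((C *v x) $ i)) - (\<Sum>i\<in>UNIV. \<gamma> i * primitive0 (\<psi> i) ((C *v y) $ i))\<bar>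
        \<le> (\<Sum>i\<in>UNIV. \<gamma> i * (M * c)) * norm (x - y)" .
    have "L * norm (x - y) = 2 * K * R * norm (x - y) + 2 * ((\<Sum>i\<in>UNIV. \<gamma> i * (M * c)) * norm (x - y))"
      by (simp only: L_def distrib_right mult.assoc)
    then show ?thesis using 1 3 unfolding V_def by linarith
  qed
  then show thesis using that by blast
qed

section \<open>Decay along solutions and the KL estimate\<close>

lemma V_has_derivative:
  fixes x :: "real \<Rightarrow> real^'n"
  assumes x: "(x has_vector_derivative v) (at t within S)"
    and w: "w \<in> kras_vec \<psi> (C *v x t)"
    and or: "\<And>i. isCont (\<psi> i) ((C *v x t) $ i) \<or> (C *v v) $ i = 0"
  shows "((\<lambda>s. V (x s)) has_real_derivative
      2 * (x t \<bullet> (P *v v)) + 2 * (\<Sum>i\<in>UNIV. \<gamma> i * (w $ i * (C *v v) $ i))) (at t within S)"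
proof -
  have lin: "((\<lambda>s. M *v x s) has_vector_derivative M *v v) (at t within S)" for M :: "real^'n^'a"
    by (rule bounded_linear.has_vector_derivative[OF matrix_vector_mul_bounded_linear x])
  have "((\<lambda>s. x s \<bullet> (P *v x s)) has_vector_derivative x t \<bullet> (P *v v) + v \<bullet> (P *v x t)) (at t within S)"
    by (rule bounded_bilinear.has_vector_derivative[OF bounded_bilinear_inner x lin])
  moreover have "v \<bullet> (P *v x t) = x t \<bullet> (P *v v)"
    using inner_transpose_mult[of v P "x t"] P_sym by (simp add: inner_commute)
  ultimately have q: "((\<lambda>s. x s \<bullet> (P *v x s)) has_real_derivative 2 * (x t \<bullet> (P *v v))) (at t within S)"
    by (simp add: has_real_derivative_iff_has_vector_derivative)
  have y: "((\<lambda>s. (C *v x s) $ i) has_real_derivative (C *v v) $ i) (at t within S)" for i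
    using bounded_linear.has_vector_derivative[OF bounded_linear_vec_nth lin]
    by (simp add: has_real_derivative_iff_has_vector_derivative)
  have "((\<lambda>s. primitive0 (\<psi> i) ((C *v x s) $ i)) has_real_derivative w $ i * (C *v v) $ i) (at t within S)" for i
    using primitive0_comp_derivative[OF pwc y _ or] w by (simp add: kras_vec_def)
  then show ?thesis unfolding V_def by (intro DERIV_add q DERIV_cmult DERIV_sum)
qed

text \<open>A constant rate fits both uses: \<open>c = 0\<close> makes \<open>V\<close>
  nonincreasing, and a negative \<open>c\<close> expresses decay while the norm stays above a
  threshold.\<close>

lemma V_decay:
  assumes sol: "di_solution (lure_F A B C \<psi>) I x" and ab: "a \<in> I" "b \<in> I" "a \<le> b"
    and c: "\<And>t. t \<in> {a..b} \<Longrightarrow> - \<eta> * (norm (x t))\<^sup>2 \<le> c"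
  shows "V (x b) - V (x a) \<le> c * (b - a)"
proof -
  have sub: "{a..b} \<subseteq> I" by (rule di_solution_subset[OF sol ab(1,2)])
  then have ac: "abs_cont_on {a..b} x" using sol by (simp add: di_solution_def)
  have "compact (x ` {a..b})" by (intro compact_continuous_image abs_cont_on_imp_continuous_on ac) auto
  then have "bounded (x ` {a..b})" by (rule compact_imp_bounded)
  then obtain R where "\<forall>z\<in>x ` {a..b}. norm z \<le> R" unfolding bounded_iff by blast
  then have R: "\<And>t. t \<in> {a..b} \<Longrightarrow> norm (x t) \<le> R" by blast
  obtain L where L: "\<And>x y. norm x \<le> R \<Longrightarrow> norm y \<le> R \<Longrightarrow> \<bar>V x - V y\<bar> \<le> L * norm (x - y)"
    using V_Lipschitz by blast
  have acV: "abs_cont_on {a..b} (\<lambda>t. V (x t))"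
    by (rule abs_cont_on_dominated[OF ac, where L = L]) (use L R in auto)
  obtain N where N: "N \<in> null_sets lebesgue"
    and der: "\<And>t. t \<in> I - N \<Longrightarrow> \<exists>v. (x has_vector_derivative v) (at t within I) \<and> v \<in> lure_F A B C \<psi> (x t)"
    using sol unfolding di_solution_def by blast
  \<comment> \<open>\<open>E i s\<close> holds the times at which output \<open>i\<close> takes the
    value \<open>s\<close> with nonzero speed. Only the countably many jump values \<open>s\<close>
    enter \<open>N'\<close>, which therefore stays a null set.\<close>
  define E where "E i s = {t \<in> {a..b}. (C *v x t) $ i = s \<and>
    (\<exists>d. d \<noteq> 0 \<and> ((\<lambda>t. (C *v x t) $ i) has_real_derivative d) (at t within {a..b}))}" for i s
  define N' where "N' = N \<union> (\<Union>i. \<Union>s\<in>{s. \<not> isCont (\<psi> i) s}. E i s)"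
  have "countable (E i s)" for i s
    unfolding E_def using countable_level_set_nonzero_derivative[of "{a..b}" "\<lambda>t. (C *v x t) $ i" s] .
  then have "countable (\<Union>i. \<Union>s\<in>{s. \<not> isCont (\<psi> i) s}. E i s)"
    using piecewise_continuous_countable_discont[OF pwc] by (intro countable_UN) auto
  then have "negligible (\<Union>i. \<Union>s\<in>{s. \<not> isCont (\<psi> i) s}. E i s)"
    unfolding negligible_iff_null_sets by (intro null_sets_completionI countable_imp_null_set_lborel)
  then have "negligible N'" unfolding N'_def using N by (simp add: negligible_iff_null_sets[symmetric])
  then show ?thesis
  proof (rule abs_cont_increment_le[OF ab(3) acV])
    fix t assume t: "t \<in> {a..b} - N'"
    then obtain v where vI: "(x has_vector_derivative v) (at t within I)" and vF: "v \<in> lure_F A B C \<psi> (x t)"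
      using der[of t] sub t unfolding N'_def by blast
    have v: "(x has_vector_derivative v) (at t within {a..b})"
      by (rule has_vector_derivative_within_subset[OF vI sub])
    obtain w where w: "w \<in> kras_vec \<psi> (C *v x t)" "v = A *v x t - B *v w"
      using vF by (auto simp: lure_F_def)
    have "isCont (\<psi> i) ((C *v x t) $ i) \<or> (C *v v) $ i = 0" for i
    proof (rule ccontr)
      assume neg: "\<not> ?thesis"
      have "((\<lambda>s. (C *v x s) $ i) has_real_derivative (C *v v) $ i) (at t within {a..b})"
        using bounded_linear.has_vector_derivative[OF bounded_linear_vec_nth
            bounded_linear.has_vector_derivative[OF matrix_vector_mul_bounded_linear v]]
        by (simp add: has_real_derivative_iff_has_vector_derivative)
      then have "t \<in> E i ((C *v x t) $ i)" using neg t unfolding E_def by blast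
      then show False using neg t unfolding N'_def by blast
    qed
    from V_has_derivative[OF v w(1) this]
    have "((\<lambda>s. V (x s)) has_real_derivative
      2 * (x t \<bullet> (P *v v)) + 2 * (\<Sum>i\<in>UNIV. \<gamma> i * (w $ i * (C *v v) $ i))) (at t within {a..b})" .
    moreover have "2 * (x t \<bullet> (P *v v)) + 2 * (\<Sum>i\<in>UNIV. \<gamma> i * (w $ i * (C *v v) $ i)) \<le> c"
      using LMI_dissipation[OF w(1)] c[of t] t unfolding w(2)[symmetric] by auto
    ultimately show "\<exists>d\<le>c. ((\<lambda>s. V (x s)) has_real_derivative d) (at t within {a..b})" by blast
  qed
qed

lemma KL_bound:
  obtains \<beta> where "class_KL \<beta>"
    "\<And>I x t. di_solution (lure_F A B C \<psi>) I x \<Longrightarrow> t \<in> I \<Longrightarrow> t \<ge> 0 \<Longrightarrow> norm (x t) \<le> \<beta> (norm (x 0)) t"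
proof -
  obtain lam where lam: "lam > 0" "\<And>x. lam * (norm x)\<^sup>2 \<le> V x" using V_lower by blast
  obtain \<alpha> where \<alpha>: "continuous_on UNIV \<alpha>" "strict_mono_on {0..} \<alpha>" "\<alpha> 0 = (0::real)" "\<And>x. V x \<le> \<alpha> (norm x)"
    using V_upper by blast
  have \<alpha>_less: "\<alpha> r < \<alpha> s" if "0 \<le> r" "r < s" for r s
    using \<alpha>(2) that by (auto simp: strict_mono_on_def)
  have \<alpha>_le: "\<alpha> r \<le> \<alpha> s" if "0 \<le> r" "r \<le> s" for r s
    using \<alpha>_less[of r s] that by (cases "r = s") auto
  have \<alpha>_nonneg: "\<alpha> r \<ge> 0" if "0 \<le> r" for r using \<alpha>_le[of 0 r] that \<alpha>(3) by simp
  \<comment> \<open>\<open>q r t\<close> is the nonnegative \<open>s\<close> with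
    \<open>(1 + \<eta> * t) * s\<^sup>2 = \<alpha> r + r\<^sup>2\<close>. Once
    \<open>V (x t) \<le> \<alpha> (q r t)\<close> is known, the lower bound \<open>lam\<close> turns
    it into the bound \<beta> on the norm.\<close>
  define q where "q r t = sqrt ((\<alpha> r + r\<^sup>2) / (1 + \<eta> * t))" for r t
  define \<beta> where "\<beta> r t = sqrt (\<alpha> (q r t) / lam)" for r t
  have den: "1 + \<eta> * t > 0" if "t \<ge> 0" for t
    using eta_pos that by (intro add_pos_nonneg) auto
  have num: "\<alpha> r + r\<^sup>2 \<ge> 0" if "r \<ge> 0" for r using \<alpha>_nonneg[OF that] by simp
  have q_nonneg: "q r t \<ge> 0" if "r \<ge> 0" "t \<ge> 0" for r t
    using num[OF that(1)] den[OF that(2)] by (simp add: q_def)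
  have cont_\<alpha>: "continuous_on S (\<lambda>r. \<alpha> (g r))" if "continuous_on S g" for S and g :: "real \<Rightarrow> real"
    by (rule continuous_on_compose2[OF \<alpha>(1) that]) auto
  have "class_K (\<lambda>r. \<beta> r t)" if t: "t \<ge> 0" for t
    unfolding class_K_def
  proof (intro conjI)
    have "1 + \<eta> * t \<noteq> 0" using den[OF t] by simp
    then show "continuous_on {0..} (\<lambda>r. \<beta> r t)" unfolding \<beta>_def q_def
      using lam(1) by (intro continuous_intros cont_\<alpha>) auto
    show "\<beta> 0 t = 0" by (simp add: \<beta>_def q_def \<alpha>(3))
    show "strict_mono_on {0..} (\<lambda>r. \<beta> r t)"
    proof (rule strict_mono_onI)
      fix r s :: real assume rs: "r \<in> {0..}" "s \<in> {0..}" "r < s"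
      have "\<alpha> r + r\<^sup>2 < \<alpha> s + s\<^sup>2" using rs by (intro add_strict_mono \<alpha>_less power_strict_mono) auto
      then have "q r t < q s t" unfolding q_def using den[OF t] by (intro real_sqrt_less_mono divide_strict_right_mono)
      then have "\<alpha> (q r t) < \<alpha> (q s t)" using rs t by (intro \<alpha>_less q_nonneg) auto
      then show "\<beta> r t < \<beta> s t" unfolding \<beta>_def using lam(1) by (intro real_sqrt_less_mono divide_strict_right_mono)
    qed
  qed
  moreover have "antimono_on {0..} (\<lambda>t. \<beta> r t)" if r: "r \<ge> 0" for r
  proof (rule monotone_onI)
    fix s t :: real assume st: "s \<in> {0..}" "t \<in> {0..}" "s \<le> t"
    have "q r t \<le> q r s" unfolding q_def using st num[OF r] den[of s] den[of t] eta_pos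
      by (intro real_sqrt_le_mono divide_left_mono) (auto intro: mult_pos_pos)
    then have "\<alpha> (q r t) \<le> \<alpha> (q r s)" using r st by (intro \<alpha>_le q_nonneg) auto
    then show "\<beta> r s \<ge> \<beta> r t" unfolding \<beta>_def using lam(1) by (intro real_sqrt_le_mono divide_right_mono) auto
  qed
  moreover have "((\<lambda>t. \<beta> r t) \<longlongrightarrow> 0) at_top" for r
  proof -
    have "filterlim (\<lambda>t. 1 + \<eta> * t) at_top at_top"
      by (intro filterlim_tendsto_add_at_top[OF tendsto_const] filterlim_tendsto_pos_mult_at_top[OF tendsto_const eta_pos] filterlim_ident)
    then have "((\<lambda>t. (\<alpha> r + r\<^sup>2) / (1 + \<eta> * t)) \<longlongrightarrow> 0) at_top"
      by (intro real_tendsto_divide_at_top[OF tendsto_const])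
    then have "((\<lambda>t. q r t) \<longlongrightarrow> 0) at_top" unfolding q_def using tendsto_real_sqrt by fastforce
    moreover have "isCont \<alpha> 0" using \<alpha>(1) by (simp add: continuous_on_eq_continuous_at)
    ultimately have "((\<lambda>t. \<alpha> (q r t)) \<longlongrightarrow> 0) at_top" using isCont_tendsto_compose[of 0 \<alpha>] \<alpha>(3) by force
    then have "((\<lambda>t. sqrt (\<alpha> (q r t) / lam)) \<longlongrightarrow> sqrt (0 / lam)) at_top" using lam(1) by (intro tendsto_intros) auto
    then show ?thesis by (simp add: \<beta>_def)
  qed
  ultimately have KL: "class_KL \<beta>" unfolding class_KL_def by blast
  have bound: "norm (x t) \<le> \<beta> (norm (x 0)) t"
    if sol: "di_solution (lure_F A B C \<psi>) I x" and t: "t \<in> I" "t \<ge> 0" for I x t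
  proof -
    define r where "r = norm (x 0)"
    have r: "r \<ge> 0" by (simp add: r_def)
    have I0: "0 \<in> I" using sol by (simp add: di_solution_def)
    then have sub: "{0..t} \<subseteq> I" using di_solution_subset[OF sol _ t(1)] by blast
    have mono: "V (x t) \<le> V (x s)" if "s \<in> {0..t}" for s
    proof -
      have "V (x t) - V (x s) \<le> 0 * (t - s)"
        using that sub t eta_pos by (intro V_decay[OF sol]) auto
      then show ?thesis by simp
    qed
    \<comment> \<open>A contradiction spares inverting \<alpha>. If \<open>V (x t)\<close> were
      larger, monotonicity would keep the norm above \<open>q r t\<close> on all of
      \<open>{0..t}\<close>, in particular \<open>q r t < r\<close>. Decay and the equation for
      \<open>q\<close> then give \<open>V (x t) \<le> (q r t)\<^sup>2 - r\<^sup>2 < 0\<close>,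
      although \<open>V\<close> is nonnegative.\<close>
    have "V (x t) \<le> \<alpha> (q r t)"
    proof (rule ccontr)
      assume "\<not> ?thesis"
      then have gt: "V (x t) > \<alpha> (q r t)" by simp
      have big: "q r t < norm (x s)" if s: "s \<in> {0..t}" for s
      proof (rule ccontr)
        assume "\<not> ?thesis"
        then have "\<alpha> (norm (x s)) \<le> \<alpha> (q r t)" by (intro \<alpha>_le) auto
        then show False using gt mono[OF s] \<alpha>(4)[of "x s"] by linarith
      qed
      have "V (x t) - V (x 0) \<le> - \<eta> * (q r t)\<^sup>2 * (t - 0)"
      proof (rule V_decay[OF sol I0 t])
        fix s assume "s \<in> {0..t}"
        then have "(q r t)\<^sup>2 \<le> (norm (x s))\<^sup>2" using big[of s] q_nonneg[OF r t(2)] by (intro power_mono) auto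
        then show "- \<eta> * (norm (x s))\<^sup>2 \<le> - \<eta> * (q r t)\<^sup>2" using eta_pos by simp
      qed
      moreover have "V (x 0) \<le> \<alpha> r" using \<alpha>(4)[of "x 0"] by (simp add: r_def)
      moreover have "(q r t)\<^sup>2 * (1 + \<eta> * t) = \<alpha> r + r\<^sup>2"
        using num[OF r] den[OF t(2)] by (simp add: q_def)
      moreover have "(q r t)\<^sup>2 < r\<^sup>2" using big[of 0] q_nonneg[OF r t(2)] t by (intro power_strict_mono) (auto simp: r_def)
      moreover have "0 \<le> lam * (norm (x t))\<^sup>2" using lam(1) by simp
      ultimately show False using lam(2)[of "x t"] by (simp add: algebra_simps)
    qed
    then have "lam * (norm (x t))\<^sup>2 \<le> \<alpha> (q r t)" using lam(2)[of "x t"] by linarith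
    then have "(norm (x t))\<^sup>2 \<le> \<alpha> (q r t) / lam" using lam(1) by (simp add: field_simps)
    then show ?thesis unfolding \<beta>_def r_def[symmetric] by (rule real_le_rsqrt)
  qed
  show thesis by (rule that[OF KL bound])
qed

section \<open>Regularity of the set-valued field\<close>

lemma kras_vec_bound:
  obtains M where "M \<ge> 0" "\<And>x w. norm x \<le> R \<Longrightarrow> w \<in> kras_vec \<psi> (C *v x) \<Longrightarrow> norm w \<le> M"
proof -
  obtain c where c: "c > 0" "\<And>x. norm (C *v x) \<le> c * norm x" using matrix_vector_mult_bound by blast
  \<comment> \<open>The extra 1 leaves room for the window of half-width 1 that bounds the
    regularization.\<close>
  obtain M where M: "M \<ge> 0" "\<And>i s. \<bar>s\<bar> \<le> c * R + 1 \<Longrightarrow> \<bar>\<psi> i s\<bar> \<le> M" using psi_bound by blast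
  have "norm w \<le> (\<Sum>i\<in>(UNIV::'p set). M)" if x: "norm x \<le> R" and w: "w \<in> kras_vec \<psi> (C *v x)" for x w
  proof -
    have "\<bar>w $ i\<bar> \<le> M" for i
    proof -
      have "c * norm x \<le> c * R" using x c(1) by (intro mult_left_mono) auto
      then have y: "\<bar>(C *v x) $ i\<bar> \<le> c * R" using component_le_norm_cart[of "C *v x" i] c(2)[of x] by linarith
      have "kras (\<psi> i) ((C *v x) $ i) \<subseteq> {-M..M}"
      proof (rule kras_subset[of 1])
        fix s assume "s \<in> {(C *v x) $ i - 1..(C *v x) $ i + 1}"
        then have "\<bar>s\<bar> \<le> c * R + 1" using y by (auto simp: abs_le_iff)
        then show "\<psi> i s \<in> {-M..M}" using M(2)[of s i] by (auto simp: abs_le_iff)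
      qed simp
      then show ?thesis using w by (auto simp: kras_vec_def abs_le_iff)
    qed
    then show ?thesis by (intro order_trans[OF norm_le_l1_cart] sum_mono)
  qed
  moreover have "(\<Sum>i\<in>(UNIV::'p set). M) \<ge> 0" using M(1) by (intro sum_nonneg) auto
  ultimately show thesis using that by blast
qed

lemma lure_F_bound:
  obtains M where "M \<ge> 0" "\<And>x v. norm x \<le> R \<Longrightarrow> v \<in> lure_F A B C \<psi> x \<Longrightarrow> norm v \<le> M"
proof -
  obtain M where M: "M \<ge> 0" "\<And>x w. norm x \<le> R \<Longrightarrow> w \<in> kras_vec \<psi> (C *v x) \<Longrightarrow> norm w \<le> M" using kras_vec_bound by blast
  obtain a where a: "a > 0" "\<And>x. norm (A *v x) \<le> a * norm x" using matrix_vector_mult_bound by blast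
  obtain b where b: "b > 0" "\<And>x. norm (B *v x) \<le> b * norm x" using matrix_vector_mult_bound by blast
  have "norm v \<le> \<bar>a * R\<bar> + b * M" if x: "norm x \<le> R" and v: "v \<in> lure_F A B C \<psi> x" for x v
  proof -
    obtain w where w: "v = A *v x - B *v w" "w \<in> kras_vec \<psi> (C *v x)" using v by (auto simp: lure_F_def)
    have "norm v \<le> norm (A *v x) + norm (B *v w)" unfolding w(1) by (rule norm_triangle_ineq4)
    also have "norm (A *v x) \<le> a * R" using a(2)[of x] mult_left_mono[OF x, of a] a(1) by linarith
    also have "norm (B *v w) \<le> b * M" using b(2)[of w] mult_left_mono[OF M(2)[OF x w(2)], of b] b(1) by linarith
    finally show ?thesis by linarith
  qed
  moreover have "\<bar>a * R\<bar> + b * M \<ge> 0" using M(1) b(1) by simp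
  ultimately show thesis using that by blast
qed

text \<open>The original closed loop with its discontinuous feedback; it selects from
  \<open>lure_F\<close> and drives the Euler scheme.\<close>

definition selection :: "real^'n \<Rightarrow> real^'n" where
  "selection x = A *v x - B *v (\<chi> i. \<psi> i ((C *v x) $ i))"

lemma selection_in_lure_F: "selection x \<in> lure_F A B C \<psi> x"
proof -
  have "(\<chi> i. \<psi> i ((C *v x) $ i)) \<in> kras_vec \<psi> (C *v x)" by (simp add: kras_vec_def kras_self)
  then show ?thesis unfolding selection_def lure_F_def by blast
qed

lemma compact_lure_F: "compact (lure_F A B C \<psi> x)"
proof -
  have eq: "kras_vec \<psi> y = (\<Inter>i. (\<lambda>w. w $ i) -` kras (\<psi> i) (y $ i))" for y by (auto simp: kras_vec_def)
  have "closed (kras_vec \<psi> (C *v x))"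
    unfolding eq by (intro closed_INT ballI closed_vimage closed_kras continuous_intros)
  moreover obtain M where M: "\<And>y w. norm y \<le> norm x \<Longrightarrow> w \<in> kras_vec \<psi> (C *v y) \<Longrightarrow> norm w \<le> M"
    using kras_vec_bound[of "norm x"] by blast
  have "bounded (kras_vec \<psi> (C *v x))" unfolding bounded_iff using M[OF order_refl] by blast
  ultimately have "compact (kras_vec \<psi> (C *v x))" by (simp add: compact_eq_bounded_closed)
  then have "compact ((\<lambda>w. A *v x - B *v w) ` kras_vec \<psi> (C *v x))"
    by (intro compact_continuous_image continuous_intros) auto
  moreover have "lure_F A B C \<psi> x = (\<lambda>w. A *v x - B *v w) ` kras_vec \<psi> (C *v x)" by (auto simp: lure_F_def)
  ultimately show ?thesis by simp
qed

lemma convex_lure_F: "convex (lure_F A B C \<psi> x)"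
proof (rule convexI)
  fix v v' :: "real^'n" and s t :: real
  assume v: "v \<in> lure_F A B C \<psi> x" "v' \<in> lure_F A B C \<psi> x" and st: "0 \<le> s" "0 \<le> t" "s + t = 1"
  obtain w where w: "v = A *v x - B *v w" "w \<in> kras_vec \<psi> (C *v x)" using v by (auto simp: lure_F_def)
  obtain w' where w': "v' = A *v x - B *v w'" "w' \<in> kras_vec \<psi> (C *v x)" using v by (auto simp: lure_F_def)
  have "s *\<^sub>R w + t *\<^sub>R w' \<in> kras_vec \<psi> (C *v x)"
    using w(2) w'(2) st by (auto simp: kras_vec_def intro!: convexD[OF convex_kras, simplified])
  moreover have "s *\<^sub>R v + t *\<^sub>R v' = (s + t) *\<^sub>R (A *v x) - B *v (s *\<^sub>R w + t *\<^sub>R w')"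
    by (simp add: w w' algebra_simps matrix_vector_right_distrib matrix_vector_mult_scaleR)
  ultimately show "s *\<^sub>R v + t *\<^sub>R v' \<in> lure_F A B C \<psi> x" using st by (auto simp: lure_F_def)
qed

text \<open>If the separation failed on every ball, points \<open>z n\<close> tending to
  \<open>x\<close> would violate it. Their \<psi>-values are bounded and converge along a
  subsequence to a point of the regularization at \<open>C *v x\<close>, which produces an element
  of \<open>lure_F\<close> on the wrong side of the hyperplane.\<close>

lemma lure_F_separation:
  assumes v: "v \<notin> lure_F A B C \<psi> x"
  shows "\<exists>a c \<rho>. \<rho> > 0 \<and> a \<bullet> v > c \<and> (\<forall>z\<in>ball x \<rho>. a \<bullet> selection z \<le> c)"
proof -
  obtain a' c' where sep: "a' \<bullet> v < c'" "\<And>u. u \<in> lure_F A B C \<psi> x \<Longrightarrow> a' \<bullet> u > c'"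
    using separating_hyperplane_closed_point[OF convex_lure_F compact_imp_closed[OF compact_lure_F] v] by blast
  have "\<exists>\<rho>>0. \<forall>z\<in>ball x \<rho>. a' \<bullet> selection z \<ge> c'"
  proof (rule ccontr)
    assume "\<not> ?thesis"
    then have "\<exists>z. z \<in> ball x (inverse (real (Suc n))) \<and> a' \<bullet> selection z < c'" for n
      by (meson inverse_positive_iff_positive not_less of_nat_0_less_iff zero_less_Suc)
    then obtain z where z: "\<And>n. z n \<in> ball x (inverse (real (Suc n)))" "\<And>n. a' \<bullet> selection (z n) < c'"
      using choice[of "\<lambda>n z. z \<in> ball x (inverse (real (Suc n))) \<and> a' \<bullet> selection z < c'"] by blast
    have zx: "z \<longlonglongrightarrow> x"
    proof (rule metric_LIMSEQ_I)
      fix e :: real assume "e > 0"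
      then obtain n0 where n0: "inverse (real (Suc n0)) < e" using reals_Archimedean by blast
      have "dist (z n) x < e" if "n \<ge> n0" for n
      proof -
        have "inverse (real (Suc n)) \<le> inverse (real (Suc n0))" using that by simp
        moreover have "dist (z n) x < inverse (real (Suc n))" using z(1)[of n] by (simp only: mem_ball dist_commute)
        ultimately show ?thesis using n0 by linarith
      qed
      then show "\<exists>n0. \<forall>n\<ge>n0. dist (z n) x < e" by blast
    qed
    define w where "w n = (\<chi> i. \<psi> i ((C *v z n) $ i))" for n
    have wk: "w n \<in> kras_vec \<psi> (C *v z n)" for n by (simp add: w_def kras_vec_def kras_self)
    obtain R where R: "\<And>n. norm (z n) \<le> R" using convergent_imp_bounded[OF zx] by (auto simp: bounded_iff)
    obtain M where M: "\<And>y w. norm y \<le> R \<Longrightarrow> w \<in> kras_vec \<psi> (C *v y) \<Longrightarrow> norm w \<le> M" using kras_vec_bound by blast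
    have "bounded (range w)" using M[OF R wk] by (auto simp: bounded_iff)
    then obtain l r where r: "strict_mono (r :: nat \<Rightarrow> nat)" and l: "(w \<circ> r) \<longlonglongrightarrow> l"
      using bounded_imp_convergent_subsequence by blast
    have zr: "(\<lambda>n. z (r n)) \<longlonglongrightarrow> x" using LIMSEQ_subseq_LIMSEQ[OF zx r] by (simp add: o_def)
    have lin: "(\<lambda>n. M *v g n) \<longlonglongrightarrow> M *v g0" if "g \<longlonglongrightarrow> g0" for M :: "real^'a^'b" and g g0
      by (rule bounded_linear.tendsto[OF matrix_vector_mul_bounded_linear that])
    have wl: "(\<lambda>n. w (r n)) \<longlonglongrightarrow> l" using l by (simp add: o_def)
    have "l $ i \<in> kras (\<psi> i) ((C *v x) $ i)" for i
    proof (rule kras_limit)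
      show "(\<lambda>n. (C *v z (r n)) $ i) \<longlonglongrightarrow> (C *v x) $ i" by (intro tendsto_vec_nth lin zr)
      show "(\<lambda>n. \<psi> i ((C *v z (r n)) $ i)) \<longlonglongrightarrow> l $ i"
        using tendsto_vec_nth[OF wl, of i] by (simp add: w_def)
    qed
    then have "A *v x - B *v l \<in> lure_F A B C \<psi> x" by (auto simp: lure_F_def kras_vec_def)
    moreover have "(\<lambda>n. a' \<bullet> selection (z (r n))) \<longlonglongrightarrow> a' \<bullet> (A *v x - B *v l)"
      unfolding selection_def w_def[symmetric] by (intro tendsto_intros lin zr wl)
    then have "a' \<bullet> (A *v x - B *v l) \<le> c'"
      by (rule LIMSEQ_le_const2) (use z(2) in \<open>auto intro: less_imp_le\<close>)
    ultimately show False using sep(2) by force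
  qed
  then obtain \<rho> where "\<rho> > 0" "\<And>z. z \<in> ball x \<rho> \<Longrightarrow> a' \<bullet> selection z \<ge> c'" by blast
  \<comment> \<open>The separating hyperplane places \<open>v\<close> below and the set above;
    negation gives the orientation of the claim.\<close>
  then have "\<rho> > 0 \<and> (- a') \<bullet> v > - c' \<and> (\<forall>z\<in>ball x \<rho>. (- a') \<bullet> selection z \<le> - c')" using sep(1) by simp
  then show ?thesis by blast
qed

lemma local_solution:
  obtains \<tau> z N L where "\<tau> > 0" "z 0 = x0" "\<And>s t. norm (z s - z t) \<le> L * \<bar>s - t\<bar>" "negligible N"
    "\<And>t. t \<in> {0<..<\<tau>} - N \<Longrightarrow> \<exists>v. (z has_vector_derivative v) (at t) \<and> v \<in> lure_F A B C \<psi> (z t)"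
proof -
  obtain M where M: "\<And>y v. norm y \<le> norm x0 + 1 \<Longrightarrow> v \<in> lure_F A B C \<psi> y \<Longrightarrow> norm v \<le> M" using lure_F_bound by blast
  have "norm (selection z) \<le> M" if "dist z x0 \<le> 1" for z
  proof (rule M[OF _ selection_in_lure_F])
    show "norm z \<le> norm x0 + 1" using norm_triangle_ineq2[of z x0] that by (simp add: dist_norm)
  qed
  then show thesis
    by (rule local_solution_exists[of x0 selection M "lure_F A B C \<psi>"]) (use lure_F_separation that in blast)+
qed

section \<open>Continuation of solutions\<close>

lemma solution_bounded:
  assumes sol: "di_solution (lure_F A B C \<psi>) I x"
  obtains R where "\<And>t. t \<in> I \<Longrightarrow> t \<ge> 0 \<Longrightarrow> norm (x t) \<le> R"
proof -
  obtain \<beta> where KL: "class_KL \<beta>" and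
    b: "\<And>I x t. di_solution (lure_F A B C \<psi>) I x \<Longrightarrow> t \<in> I \<Longrightarrow> t \<ge> 0 \<Longrightarrow> norm (x t) \<le> \<beta> (norm (x 0)) t"
    using KL_bound by blast
  have "antimono_on {0..} (\<lambda>t. \<beta> (norm (x 0)) t)" using KL by (simp add: class_KL_def)
  then have "\<beta> (norm (x 0)) t \<le> \<beta> (norm (x 0)) 0" if "t \<ge> 0" for t
    using that by (auto dest: monotone_onD)
  then have "norm (x t) \<le> \<beta> (norm (x 0)) 0" if "t \<in> I" "t \<ge> 0" for t
    using b[OF sol that] that(2) order_trans by blast
  then show thesis using that by blast
qed

text \<open>The inclusion is autonomous, so a local solution started at \<open>x b\<close> and
  shifted by \<open>b\<close> continues the given one. The two velocities need not match at the
  joint, which joins the exceptional null set.\<close>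

lemma extend_past_endpoint:
  assumes sol: "di_solution (lure_F A B C \<psi>) I x" and b: "b \<in> I" and ub: "\<And>t. t \<in> I \<Longrightarrow> t \<le> b"
  shows "\<exists>J y. di_solution (lure_F A B C \<psi>) J y \<and> I \<subset> J \<and> (\<forall>t\<in>I. y t = x t)"
proof -
  let ?F = "lure_F A B C \<psi>"
  obtain \<tau> z Nz L where z: "\<tau> > 0" "z 0 = x b" "\<And>s t. norm (z s - z t) \<le> L * \<bar>s - t\<bar>" "negligible Nz"
    "\<And>t. t \<in> {0<..<\<tau>} - Nz \<Longrightarrow> \<exists>v. (z has_vector_derivative v) (at t) \<and> v \<in> ?F (z t)"
    by (rule local_solution[of "x b"]) (rule that)
  obtain N where N: "N \<in> null_sets lebesgue"
    and der: "\<And>t. t \<in> I - N \<Longrightarrow> \<exists>v. (x has_vector_derivative v) (at t within I) \<and> v \<in> ?F (x t)"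
    using sol unfolding di_solution_def by blast
  \<comment> \<open>Half of \<tau> keeps the closed right end inside the open range on which
    \<open>z\<close> satisfies the inclusion.\<close>
  define J where "J = I \<union> {b..b + \<tau> / 2}"
  define y where "y t = (if t \<le> b then x t else z (t - b))" for t
  have I0: "0 \<in> I" using sol by (simp add: di_solution_def)
  have yI: "y t = x t" if "t \<in> I" for t using ub[OF that] by (simp add: y_def)
  have yz: "y t = z (t - b)" if "t \<ge> b" for t using that z(2) by (auto simp: y_def)
  have JI: "t \<in> I" if "t \<in> J" "t \<le> b" for t using that b by (auto simp: J_def)
  have "is_interval J" unfolding is_interval_1
  proof (intro ballI allI impI, elim conjE)
    fix p q t assume pq: "p \<in> J" "q \<in> J" "p \<le> t" "t \<le> q"
    show "t \<in> J"
    proof (cases "t \<le> b")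
      case True
      then have "p \<in> I" using pq JI by simp
      then have "t \<in> I" using di_solution_subset[OF sol _ b, of p] True pq by auto
      then show ?thesis by (simp add: J_def)
    next
      case False
      then have "q \<le> b + \<tau> / 2" using pq ub[of q] by (auto simp: J_def)
      then show ?thesis using False pq by (simp add: J_def)
    qed
  qed
  moreover have "0 \<in> J" using I0 by (simp add: J_def)
  moreover have "abs_cont_on {p..q} y" if pq: "{p..q} \<subseteq> J" for p q
  proof -
    have acI: "abs_cont_on {p'..q'} y" if "{p'..q'} \<subseteq> I" for p' q'
    proof (rule abs_cont_on_dominated[where g = x and L = 1])
      show "abs_cont_on {p'..q'} x" using sol that by (simp add: di_solution_def)
    next
      fix u v assume "u \<in> {p'..q'}" "v \<in> {p'..q'}"
      then have "u \<in> I" "v \<in> I" using that by blast+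
      then show "norm (y v - y u) \<le> 1 * norm (x v - x u)" by (simp add: yI)
    qed
    have acz: "abs_cont_on {b..q} y"
    proof (rule Lipschitz_imp_abs_cont_on[where L = L])
      fix u v assume "u \<in> {b..q}" "v \<in> {b..q}"
      then show "norm (y v - y u) \<le> L * \<bar>v - u\<bar>" using z(3)[of "v - b" "u - b"] by (simp add: yz)
    qed
    show ?thesis
    proof (cases "q \<le> b")
      case True
      then have "{p..q} \<subseteq> I" using pq JI by auto
      then show ?thesis by (rule acI)
    next
      case False
      have "{p..b} \<subseteq> I"
      proof
        fix t assume t: "t \<in> {p..b}"
        then have "t \<in> J" using pq False by auto
        then show "t \<in> I" using JI t by simp
      qed
      then show ?thesis by (rule abs_cont_on_combine[OF acI acz])
    qed
  qed
  moreover have "\<exists>N. N \<in> null_sets lebesgue \<and> (\<forall>t \<in> J - N. \<exists>v. (y has_vector_derivative v) (at t within J) \<and> v \<in> ?F (y t))"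
  proof (intro exI[of _ "N \<union> ({b} \<union> (+) b ` Nz)"] conjI ballI)
    have "negligible ((+) b ` Nz)" using z(4) by (rule negligible_translation)
    then show "N \<union> ({b} \<union> (+) b ` Nz) \<in> null_sets lebesgue"
      using N by (simp add: negligible_iff_null_sets[symmetric])
    fix t assume t: "t \<in> J - (N \<union> ({b} \<union> (+) b ` Nz))"
    show "\<exists>v. (y has_vector_derivative v) (at t within J) \<and> v \<in> ?F (y t)"
    proof (cases "t < b")
      case True
      then have tI: "t \<in> I" using t JI by simp
      then obtain v where v: "(x has_vector_derivative v) (at t within I)" "v \<in> ?F (x t)" using der t by blast
      \<comment> \<open>To the left of \<open>b\<close> the two intervals contain the same points,
        so the relative derivatives coincide.\<close>
      have "at t within I = at t within J"
        by (rule at_within_nhd[of t "{..<b}"]) (use True JI in \<open>auto simp: J_def\<close>)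
      then have "(x has_vector_derivative v) (at t within J)" using v(1) by simp
      then have "(y has_vector_derivative v) (at t within J)"
        by (rule has_vector_derivative_transform_within[where d = "b - t"]) (use True t in \<open>auto simp: y_def dist_real_def\<close>)
      then show ?thesis using v(2) yI[OF tI] by auto
    next
      case False
      then have tb: "t > b" "t \<le> b + \<tau> / 2" using t ub[of t] by (auto simp: J_def)
      have "t - b \<notin> Nz" using t by (auto simp: image_iff)
      then obtain v where v: "(z has_vector_derivative v) (at (t - b))" "v \<in> ?F (z (t - b))"
        using z(5)[of "t - b"] tb z(1) by auto
      have "((\<lambda>t. t - b) has_vector_derivative 1) (at t)" by (auto intro!: derivative_eq_intros)
      then have "(z \<circ> (\<lambda>t. t - b) has_vector_derivative 1 *\<^sub>R v) (at t)"
        by (rule vector_diff_chain_at) (rule v(1))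
      then have "(y has_vector_derivative 1 *\<^sub>R v) (at t)"
        by (rule has_vector_derivative_transform_within_open[of _ _ _ "{b<..}"]) (use tb yz in auto)
      then show ?thesis using v(2) yz[of t] tb(1) by (auto intro: has_vector_derivative_at_within)
    qed
  qed
  ultimately have "di_solution ?F J y" by (simp add: di_solution_def)
  moreover have "I \<subset> J"
  proof
    show "I \<subseteq> J" by (simp add: J_def)
    have "b + \<tau> / 2 \<notin> I" using ub[of "b + \<tau> / 2"] z(1) by auto
    moreover have "b + \<tau> / 2 \<in> J" using z(1) by (simp add: J_def)
    ultimately show "I \<noteq> J" by blast
  qed
  ultimately show ?thesis using yI by blast
qed

text \<open>The a priori bound concerns nonnegative times. On \<open>{0..<b}\<close> it bounds the
  velocity, so \<open>x\<close> is Lipschitz there and has a limit at \<open>b\<close>, which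
  becomes the added value.\<close>

lemma extend_to_endpoint:
  assumes sol: "di_solution (lure_F A B C \<psi>) I x" and b: "b \<notin> I" "b > 0"
    and ub: "\<And>t. t \<in> I \<Longrightarrow> t < b" and lb: "\<And>t. 0 \<le> t \<Longrightarrow> t < b \<Longrightarrow> t \<in> I"
  shows "\<exists>J y. di_solution (lure_F A B C \<psi>) J y \<and> I \<subset> J \<and> (\<forall>t\<in>I. y t = x t)"
proof -
  let ?F = "lure_F A B C \<psi>"
  obtain N where N: "N \<in> null_sets lebesgue"
    and der: "\<And>t. t \<in> I - N \<Longrightarrow> \<exists>v. (x has_vector_derivative v) (at t within I) \<and> v \<in> ?F (x t)"
    using sol unfolding di_solution_def by blast
  obtain R where R: "\<And>t. t \<in> I \<Longrightarrow> t \<ge> 0 \<Longrightarrow> norm (x t) \<le> R" using solution_bounded[OF sol] by blast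
  obtain M where M: "M \<ge> 0" "\<And>x v. norm x \<le> R \<Longrightarrow> v \<in> ?F x \<Longrightarrow> norm v \<le> M" using lure_F_bound by blast
  have lip1: "norm (x t - x s) \<le> M * (t - s)" if st: "0 \<le> s" "s \<le> t" "t < b" for s t
  proof (rule abs_cont_norm_increment_le[OF st(2)])
    have sub: "{s..t} \<subseteq> I" using st lb by auto
    then show "abs_cont_on {s..t} x" using sol by (simp add: di_solution_def)
    show "negligible N" using N by (simp add: negligible_iff_null_sets)
    fix u assume u: "u \<in> {s..t} - N"
    then obtain v where v: "(x has_vector_derivative v) (at u within I)" "v \<in> ?F (x u)" using der sub by blast
    have "norm v \<le> M" using M(2)[OF R v(2)] u sub st by auto
    then show "\<exists>v. (x has_vector_derivative v) (at u within {s..t}) \<and> norm v \<le> M"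
      using has_vector_derivative_within_subset[OF v(1) sub] by blast
  qed
  have lip: "norm (x t - x s) \<le> M * \<bar>t - s\<bar>" if "s \<in> {0..<b}" "t \<in> {0..<b}" for s t
    using lip1[of s t] lip1[of t s] that by (cases "s \<le> t") (auto simp: norm_minus_commute)
  \<comment> \<open>This starts at 0 for \<open>n = 0\<close> and tends to \<open>b\<close> without
    reaching it, so every term lies in \<open>{0..<b}\<close>.\<close>
  define u where "u n = b - b / real (Suc n)" for n
  have u: "u n \<in> {0..<b}" for n using b(2) by (auto simp: u_def field_simps)
  have "(\<lambda>n. b / real (Suc n)) \<longlonglongrightarrow> 0" using LIMSEQ_Suc[OF lim_const_over_n] by blast
  then have "(\<lambda>n. b - b / real (Suc n)) \<longlonglongrightarrow> b - 0" by (intro tendsto_intros)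
  then have ub_lim: "u \<longlonglongrightarrow> b" by (simp add: u_def[abs_def])
  have "M-lipschitz_on {0..<b} x" using lip M(1) by (intro lipschitz_onI) (auto simp: dist_norm)
  then have "uniformly_continuous_on {0..<b} x" by (rule lipschitz_on_uniformly_continuous)
  then have "Cauchy (\<lambda>n. x (u n))"
    by (rule uniformly_continuous_on_Cauchy[OF _ LIMSEQ_imp_Cauchy[OF ub_lim] u])
  then obtain l where l: "(\<lambda>n. x (u n)) \<longlonglongrightarrow> l" using Cauchy_convergent_iff convergent_def by blast
  have lipl: "norm (l - x s) \<le> M * (b - s)" if s: "s \<in> {0..<b}" for s
  proof (rule LIMSEQ_le)
    show "(\<lambda>n. norm (x (u n) - x s)) \<longlonglongrightarrow> norm (l - x s)" by (intro tendsto_intros l)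
    have "(\<lambda>n. M * \<bar>u n - s\<bar>) \<longlonglongrightarrow> M * \<bar>b - s\<bar>" by (intro tendsto_intros ub_lim)
    then show "(\<lambda>n. M * \<bar>u n - s\<bar>) \<longlonglongrightarrow> M * (b - s)" using s by simp
    show "\<exists>n0. \<forall>n\<ge>n0. norm (x (u n) - x s) \<le> M * \<bar>u n - s\<bar>" using lip[OF s u] by blast
  qed
  define J where "J = insert b I"
  define y where "y t = (if t = b then l else x t)" for t
  have I0: "0 \<in> I" using sol by (simp add: di_solution_def)
  have yI: "y t = x t" if "t \<in> I" for t using that b(1) by (auto simp: y_def)
  have "is_interval J" unfolding is_interval_1
  proof (intro ballI allI impI, elim conjE)
    fix p q t assume pq: "p \<in> J" "q \<in> J" "p \<le> t" "t \<le> q"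
    have "q \<le> b" using pq(2) ub[of q] by (auto simp: J_def)
    show "t \<in> J"
    proof (cases "t = b")
      case False
      then have tb: "t < b" using pq \<open>q \<le> b\<close> by linarith
      then have p: "p \<in> I" using pq by (auto simp: J_def)
      have "t \<in> I"
      proof (cases "t \<ge> 0")
        case True then show ?thesis using lb tb by blast
      next
        case False
        then show ?thesis using di_solution_subset[OF sol p I0] pq(3) by auto
      qed
      then show ?thesis by (simp add: J_def)
    qed (simp add: J_def)
  qed
  moreover have "0 \<in> J" using I0 by (simp add: J_def)
  moreover have "abs_cont_on {p..q} y" if pq: "{p..q} \<subseteq> J" for p q
  proof -
    have acI: "abs_cont_on {p'..q'} y" if "{p'..q'} \<subseteq> I" for p' q'
    proof (rule abs_cont_on_dominated[where g = x and L = 1])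
      show "abs_cont_on {p'..q'} x" using sol that by (simp add: di_solution_def)
    next
      fix u v assume "u \<in> {p'..q'}" "v \<in> {p'..q'}"
      then have "u \<in> I" "v \<in> I" using that by blast+
      then show "norm (y v - y u) \<le> 1 * norm (x v - x u)" by (simp add: yI)
    qed
    have ac0: "abs_cont_on {0..b} y"
    proof (rule Lipschitz_imp_abs_cont_on[where L = M])
      fix s t assume st: "s \<in> {0..b}" "t \<in> {0..b}"
      have "s = b \<or> s \<in> {0..<b}" "t = b \<or> t \<in> {0..<b}" using st by auto
      then show "norm (y t - y s) \<le> M * \<bar>t - s\<bar>"
        using lip[of s t] lipl[of s] lipl[of t] by (auto simp: y_def norm_minus_commute)
    qed
    show ?thesis
    proof (cases "b \<in> {p..q}")
      case False
      then have "{p..q} \<subseteq> I" using pq by (auto simp: J_def)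
      then show ?thesis by (rule acI)
    next
      case True
      then have "q \<in> J" using pq by auto
      then have q: "q = b" using True ub[of q] by (auto simp: J_def)
      \<comment> \<open>The Lipschitz estimate begins at time 0; earlier times inherit absolute
        continuity from \<open>x\<close>, and the pieces meet at 0.\<close>
      have "{p..0} \<subseteq> I"
      proof
        fix t assume t: "t \<in> {p..0}"
        then have "t \<in> J" using pq True b(2) by auto
        then show "t \<in> I" using t b(2) by (auto simp: J_def)
      qed
      then show ?thesis unfolding q by (rule abs_cont_on_combine[OF acI ac0])
    qed
  qed
  moreover have "\<exists>N. N \<in> null_sets lebesgue \<and> (\<forall>t \<in> J - N. \<exists>v. (y has_vector_derivative v) (at t within J) \<and> v \<in> ?F (y t))"
  proof (intro exI[of _ "N \<union> {b}"] conjI ballI)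
    show "N \<union> {b} \<in> null_sets lebesgue"
      using N by (simp add: negligible_iff_null_sets[symmetric])
    fix t assume t: "t \<in> J - (N \<union> {b})"
    then have tI: "t \<in> I" by (simp add: J_def)
    then have tb: "t < b" by (rule ub)
    obtain v where v: "(x has_vector_derivative v) (at t within I)" "v \<in> ?F (x t)" using der t tI by blast
    have "at t within I = at t within J"
      by (rule at_within_nhd[of t "{..<b}"]) (use tb in \<open>auto simp: J_def\<close>)
    then have "(x has_vector_derivative v) (at t within J)" using v(1) by simp
    then have "(y has_vector_derivative v) (at t within J)"
      by (rule has_vector_derivative_transform_within[where d = "b - t"]) (use tb t in \<open>auto simp: y_def dist_real_def\<close>)
    then show "\<exists>v. (y has_vector_derivative v) (at t within J) \<and> v \<in> ?F (y t)" using v(2) yI[OF tI] by auto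
  qed
  ultimately have "di_solution ?F J y" by (simp add: di_solution_def)
  moreover have "I \<subset> J" using b(1) by (auto simp: J_def)
  ultimately show ?thesis using yI by blast
qed

text \<open>An interval that contains 0 and misses some nonnegative \<open>T\<close> is bounded
  above. Whether or not its supremum belongs to it, one of the two extensions contradicts
  maximality.\<close>

lemma maximal_solution_global:
  assumes max: "di_maximal_solution (lure_F A B C \<psi>) I x"
  shows "{0..} \<subseteq> I"
proof (rule ccontr)
  assume "\<not> ?thesis"
  then obtain T where T: "T \<ge> 0" "T \<notin> I" by auto
  have sol: "di_solution (lure_F A B C \<psi>) I x" using max by (simp add: di_maximal_solution_def)
  then have I0: "0 \<in> I" by (simp add: di_solution_def)
  have ubT: "t \<le> T" if "t \<in> I" for t
    using di_solution_subset[OF sol I0 that] T by force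
  then have bdd: "bdd_above I" by (rule bdd_aboveI)
  define b where "b = Sup I"
  have ub: "t \<le> b" if "t \<in> I" for t unfolding b_def using that bdd by (rule cSup_upper)
  have "\<exists>J y. di_solution (lure_F A B C \<psi>) J y \<and> I \<subset> J \<and> (\<forall>t\<in>I. y t = x t)"
  proof (cases "b \<in> I")
    case True
    then show ?thesis by (rule extend_past_endpoint[OF sol _ ub])
  next
    case False
    show ?thesis
    proof (rule extend_to_endpoint[OF sol False])
      show "b > 0" using ub[OF I0] I0 False by (cases "b = 0") auto
      show "t < b" if "t \<in> I" for t using ub[OF that] that False by (cases "t = b") auto
      fix t assume t: "0 \<le> t" "t < b"
      then obtain s where "s \<in> I" "t < s" unfolding b_def using less_cSup_iff[OF _ bdd] I0 by blast
      then show "t \<in> I" using di_solution_subset[OF sol I0, of s] t by auto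
    qed
  qed
  then show False using max by (simp add: di_maximal_solution_def)
qed

end

theorem theorem1:
  fixes A :: "real^'n^'n" and B :: "real^'p^'n" and C :: "real^'n^'p"
    and \<psi> :: "'p \<Rightarrow> real \<Rightarrow> real" and \<zeta> :: "'p \<Rightarrow> ereal"
    and \<gamma> :: "'p \<Rightarrow> real" and P :: "real^'n^'n" and \<eta> :: real
  assumes pwc: "\<And>i. piecewise_continuous (\<psi> i)"
    and zeta_pos: "\<And>i. \<zeta> i > 0"
    and sector_fin: "\<And>i s. \<zeta> i \<noteq> \<infinity> \<Longrightarrow> \<psi> i s * (\<psi> i s - real_of_ereal (\<zeta> i) * s) \<le> 0"
    and sector_inf: "\<And>i s. \<zeta> i = \<infinity> \<Longrightarrow> \<psi> i s * s \<ge> 0"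
    and gamma_pos: "\<And>i. \<gamma> i > 0"
    and P_sym: "transpose P = P"
    and P_pos: "\<And>\<xi>. \<xi> \<noteq> 0 \<Longrightarrow> \<xi> \<bullet> (P *v \<xi>) > 0"
    and eta_pos: "\<eta> > 0"
    and LMI: "\<And>\<xi> \<omega>.
       \<xi> \<bullet> ((P ** A + transpose A ** P + \<eta> *\<^sub>R mat 1) *v \<xi>)
       + 2 * (\<xi> \<bullet> ((P ** B - transpose (C + diag_mat \<gamma> ** C ** A)) *v \<omega>))
       + \<omega> \<bullet> ((- 2 *\<^sub>R diag_mat (\<lambda>i. inv_ereal0 (\<zeta> i))
                 - diag_mat \<gamma> ** C ** B - transpose (diag_mat \<gamma> ** C ** B)) *v \<omega>) \<le> 0"
  shows "(\<forall>I x. di_maximal_solution (lure_F A B C \<psi>) I x \<longrightarrow> {0..} \<subseteq> I) \<and>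
         (\<exists>\<beta>. class_KL \<beta> \<and>
            (\<forall>I x. di_solution (lure_F A B C \<psi>) I x \<longrightarrow>
               (\<forall>t\<in>I. t \<ge> 0 \<longrightarrow> norm (x t) \<le> \<beta> (norm (x 0)) t)))"
proof -
  interpret lure_system A B C \<psi> \<zeta> \<gamma> P \<eta>
    by unfold_locales (fact pwc, fact zeta_pos, fact sector_fin, fact sector_inf, fact gamma_pos,
        fact P_sym, fact P_pos, fact eta_pos, fact LMI)
  obtain \<beta> where "class_KL \<beta>"
    "\<And>I x t. di_solution (lure_F A B C \<psi>) I x \<Longrightarrow> t \<in> I \<Longrightarrow> t \<ge> 0 \<Longrightarrow> norm (x t) \<le> \<beta> (norm (x 0)) t"
    using KL_bound by blast
  then show ?thesis using maximal_solution_global by blast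
qed

end
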